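(* Let $0\le\underline c<\bar c$ and $S=[\underline c,\bar c]$. Let $\{C_{x,c}\in\Pi^S_{x,c}:(x,c)\in[0,\infty)\times[\underline c,\bar c]\}$ be a family of admissible strategies. If $W(x,c):=J(x;C_{x,c})$ is a viscosity supersolution of $\max\{\mathcal L^c(u)(x,c),\partial_cu(x,c)\}=0$ in $(0,\infty)\times[\underline c,\bar c)$ with $W(0,c)=0$ and $\lim_{x\to\infty}W(x,c)=\bar c/q$, then $W=V^S$. Moreover, if for each $k\ge1$ there is a family $\{C^k_{x,c}\in\Pi^S_{x,c}\}$ such that $W(x,c):=\lim_{k\to\infty}J(x;C^k_{x,c})$ exists and is a viscosity supersolution of the same equation in $(0,\infty)\times[\underline c,\bar c)$ with $W(0,c)=0$ and $\lim_{x\to\infty}W(x,c)=\bar c/q$, then $W=V^S$.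
   Context: Fix constants $\mu>0$, $\sigma>0$, $q>0$. Let $W$ be a standard Brownian motion and $X_t=x+\mu t+\sigma W_t$, with $(\mathcal F_t)_{t\ge0}$ the completed filtration generated by $X$. For a set $S\subset[0,\infty)$ with $\bar c=\max S<\infty$, $x\ge0$ and $c\in S$, let $\Pi^S_{x,c}$ be the set of processes $C=(C_t)_{t\ge0}$ that are non-decreasing, right-continuous, $(\mathcal F_t)$-adapted, with $C_t\in S$ and $C_t\ge c$ for all $t$. The controlled surplus is $X^C_t=X_t-\int_0^tC_s\,ds$, the ruin time is $\tau=\inf\{t\ge0:X^C_t<0\}$, $J(x;C)=\mathbb E[\int_0^\tau e^{-qs}C_s\,ds]$, and $V^S(x,c)=\sup_{C\in\Pi^S_{x,c}}J(x;C)$. For $c\ge0$, $\mathcal L^c(W)=\frac{\sigma^2}{2}\partial_{xx}W+(\mu-c)\partial_xW-qW+c$. A function $f:[0,\infty)\times[\underline c,\bar c)\to\mathbb R$ is (2,1)-differentiable if $f$ is continuously differentiable and $\partial_xf(\cdot,c)$ is continuously differentiable. A locally Lipschitz $\bar u$ is a viscosity supersolution at $(x,c)$ if every (2,1)-differentiable $\varphi$ with $\varphi(x,c)=\bar u(x,c)$ such that $\bar u-\varphi$ attains its minimum at $(x,c)$ satisfies $\max\{\mathcal L^c(\varphi)(x,c),\partial_c\varphi(x,c)\}\le0$. *)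

theory Defs
  imports "HOL-Probability.Probability"
begin

definition std_BM :: "'a measure \<Rightarrow> (real \<Rightarrow> 'a \<Rightarrow> real) \<Rightarrow> bool" where
  "std_BM M B \<longleftrightarrow> prob_space M \<and>
     (\<forall>t. B t \<in> borel_measurable M) \<and>
     (\<forall>\<omega>\<in>space M. B 0 \<omega> = 0 \<and> continuous_on {0..} (\<lambda>t. B t \<omega>)) \<and>
     (\<forall>s t. 0 \<le> s \<and> s < t \<longrightarrow>
        distributed M lborel (\<lambda>\<omega>. B t \<omega> - B s \<omega>) (normal_density 0 (sqrt (t - s)))) \<and>
     (\<forall>(ts::nat \<Rightarrow> real) n. 0 \<le> ts 0 \<and> strict_mono ts \<longrightarrow>
        prob_space.indep_vars M (\<lambda>_. borel) (\<lambda>i \<omega>. B (ts (Suc i)) \<omega> - B (ts i) \<omega>) {..<n})"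

definition Xproc :: "real \<Rightarrow> real \<Rightarrow> (real \<Rightarrow> 'a \<Rightarrow> real) \<Rightarrow> real \<Rightarrow> real \<Rightarrow> 'a \<Rightarrow> real" where
  "Xproc mu sig B x t \<omega> = x + mu * t + sig * B t \<omega>"

definition filt :: "'a measure \<Rightarrow> (real \<Rightarrow> 'a \<Rightarrow> real) \<Rightarrow> real \<Rightarrow> 'a measure" where
  "filt M X t = sigma (space M)
     ({X s -` A \<inter> space M | s A. 0 \<le> s \<and> s \<le> t \<and> A \<in> sets borel} \<union>
      {N. N \<subseteq> space M \<and> (\<exists>A\<in>null_sets M. N \<subseteq> A)})"

definition admissible :: "'a measure \<Rightarrow> real \<Rightarrow> real \<Rightarrow> (real \<Rightarrow> 'a \<Rightarrow> real) \<Rightarrow> real set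
    \<Rightarrow> real \<Rightarrow> real \<Rightarrow> (real \<Rightarrow> 'a \<Rightarrow> real) set" where
  "admissible M mu sig B S x c = {C.
     (\<forall>\<omega>\<in>space M. mono_on {0..} (\<lambda>t. C t \<omega>) \<and>
        (\<forall>t\<ge>0. continuous (at_right t) (\<lambda>s. C s \<omega>)) \<and>
        (\<forall>t\<ge>0. C t \<omega> \<in> S \<and> c \<le> C t \<omega>)) \<and>
     (\<forall>t\<ge>0. C t \<in> borel_measurable (filt M (Xproc mu sig B x) t))}"

definition surplus :: "real \<Rightarrow> real \<Rightarrow> (real \<Rightarrow> 'a \<Rightarrow> real) \<Rightarrow> real \<Rightarrow> (real \<Rightarrow> 'a \<Rightarrow> real)
    \<Rightarrow> real \<Rightarrow> 'a \<Rightarrow> real" where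
  "surplus mu sig B x C t \<omega> = Xproc mu sig B x t \<omega> - integral {0..t} (\<lambda>s. C s \<omega>)"

text \<open>Ruin time (inf of the empty set is +oo).\<close>
definition ruin_time :: "real \<Rightarrow> real \<Rightarrow> (real \<Rightarrow> 'a \<Rightarrow> real) \<Rightarrow> real \<Rightarrow> (real \<Rightarrow> 'a \<Rightarrow> real)
    \<Rightarrow> 'a \<Rightarrow> ereal" where
  "ruin_time mu sig B x C \<omega> = Inf {ereal t | t. 0 \<le> t \<and> surplus mu sig B x C t \<omega> < 0}"

definition Jval :: "'a measure \<Rightarrow> real \<Rightarrow> real \<Rightarrow> real \<Rightarrow> (real \<Rightarrow> 'a \<Rightarrow> real) \<Rightarrow> real
    \<Rightarrow> (real \<Rightarrow> 'a \<Rightarrow> real) \<Rightarrow> real" where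
  "Jval M mu sig q B x C = enn2real (\<integral>\<^sup>+ \<omega>.
     (\<integral>\<^sup>+ s. indicator {s. 0 \<le> s \<and> ereal s < ruin_time mu sig B x C \<omega>} s
              * ennreal (exp (- q * s) * C s \<omega>) \<partial>lborel) \<partial>M)"

definition Vval :: "'a measure \<Rightarrow> real \<Rightarrow> real \<Rightarrow> real \<Rightarrow> (real \<Rightarrow> 'a \<Rightarrow> real) \<Rightarrow> real set
    \<Rightarrow> real \<Rightarrow> real \<Rightarrow> real" where
  "Vval M mu sig q B S x c = (SUP C \<in> admissible M mu sig B S x c. Jval M mu sig q B x C)"

text \<open>L^c applied to a function with value u, first x-derivative ux, second x-derivative uxx.\<close>
definition gen_op :: "real \<Rightarrow> real \<Rightarrow> real \<Rightarrow> real \<Rightarrow> real \<Rightarrow> real \<Rightarrow> real \<Rightarrow> real" where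
  "gen_op mu sig q c u ux uxx = sig\<^sup>2 / 2 * uxx + (mu - c) * ux - q * u + c"

definition diff21 :: "real \<Rightarrow> real \<Rightarrow> (real \<times> real \<Rightarrow> real) \<Rightarrow> (real \<times> real \<Rightarrow> real)
    \<Rightarrow> (real \<times> real \<Rightarrow> real) \<Rightarrow> (real \<times> real \<Rightarrow> real) \<Rightarrow> bool" where
  "diff21 clo chi phi phix phic phixx \<longleftrightarrow>
     (let D = {0..} \<times> {clo..<chi} in
       (\<forall>p\<in>D. (phi has_derivative (\<lambda>(h,k). phix p * h + phic p * k)) (at p within D)) \<and>
       continuous_on D phix \<and> continuous_on D phic \<and>
       (\<forall>c\<in>{clo..<chi}.
          (\<forall>x\<ge>0. ((\<lambda>y. phix (y, c)) has_real_derivative phixx (x, c)) (at x within {0..})) \<and>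
          continuous_on {0..} (\<lambda>y. phixx (y, c))))"

definition loc_lipschitz_on :: "(real \<times> real) set \<Rightarrow> (real \<times> real \<Rightarrow> real) \<Rightarrow> bool" where
  "loc_lipschitz_on D u \<longleftrightarrow> (\<forall>p\<in>D. \<exists>e>0. \<exists>L. \<forall>a\<in>D \<inter> ball p e. \<forall>b\<in>D \<inter> ball p e.
      \<bar>u a - u b\<bar> \<le> L * dist a b)"

definition visc_super :: "real \<Rightarrow> real \<Rightarrow> real \<Rightarrow> real \<Rightarrow> real \<Rightarrow> (real \<times> real \<Rightarrow> real) \<Rightarrow> bool" where
  "visc_super mu sig q clo chi u \<longleftrightarrow>
     loc_lipschitz_on ({0..} \<times> {clo..<chi}) u \<and>
     (\<forall>x c. 0 < x \<and> clo \<le> c \<and> c < chi \<longrightarrow>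
        (\<forall>phi phix phic phixx. diff21 clo chi phi phix phic phixx \<and> phi (x, c) = u (x, c) \<and>
           (\<forall>p\<in>{0..} \<times> {clo..<chi}. u p - phi p \<ge> u (x, c) - phi (x, c)) \<longrightarrow>
           max (gen_op mu sig q c (phi (x, c)) (phix (x, c)) (phixx (x, c))) (phic (x, c)) \<le> 0))"

end

theory Submission
  imports Defs "HOL-Real_Asymp.Real_Asymp"
begin

text \<open>
  Only \<open>Jval x C \<le> W (x, c)\<close> for admissible \<open>C\<close> and \<open>c < chi\<close> needs work. Testing with separable functions
  shows that \<open>W\<close> is nonincreasing in \<open>c\<close> and that, for fixed \<open>c\<close>, \<open>W\<close> dominates on an interval every solution
  \<open>c / q + A * exp (th1 * x) + B * exp (th2 * x)\<close> of the linear equation which it dominates at the end points.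
  This is a concavity property, so through every point of the graph there passes a solution lying above \<open>W\<close> on the
  whole half line. Such exponential solutions are integrated exactly against the Gaussian transition, which
  yields a one-step supermartingale inequality without stochastic calculus.

  An arbitrary strategy is compared with one that is frozen on a time grid of step \<open>t\<close> and rounded down to finitely many
  values, with ruin observed on the grid only. Shifting \<open>W\<close> by \<open>eps\<close> in the space variable makes the error of ignoring ruin
  within one step of order \<open>exp (- eps / sqrt t)\<close>, hence negligible after summing over all steps. Then
  \<open>t\<close>, the mesh of the rounding and \<open>eps\<close> tend to 0 in this order.
\<close>

section \<open>Viscosity supersolutions\<close>

text \<open>Only the supersolution side is hard: W is itself a limit of payoffs, so it lies below
  the value. The equation is assumed only for x > 0 and levels below \<open>chi\<close>, and W is
  merely locally Lipschitz, so Ito's formula cannot be applied to it. Hence smooth supporting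
  solutions replace derivatives of W; the level is held constant over a step, where only the linear
  operator of that level acts, and monotonicity in c lets it rise between steps for free; rounding
  goes to levels strictly below \<open>chi\<close>, and the level \<open>chi\<close> itself is
  treated by hand.

  The shift repairs a defect of the supporting solution: it dominates W only on the positive half
  line and may be negative beyond, where the Gaussian puts mass. At distance at least
  \<open>eps\<close> from the edge, its negative part has a coefficient bounded uniformly in the
  starting point and matters only for increments at most \<open>- eps\<close>. The error of one step
  is multiplied by 1 / (1 - exp (- q * t)), the discounted number of steps, and its constant depends
  on \<open>eps\<close> and on the finite set of levels; therefore t has to tend to 0 while these
  are fixed.\<close>

lemma loc_lipschitz_on_imp_continuous_on:
  assumes "loc_lipschitz_on D u"
  shows "continuous_on D u"
  unfolding continuous_on_iff
proof (intro ballI allI impI)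
  fix p and e :: real
  assume p: "p \<in> D" and e: "0 < e"
  obtain r L where r: "r > 0"
    and L: "\<And>a b. a \<in> D \<inter> ball p r \<Longrightarrow> b \<in> D \<inter> ball p r \<Longrightarrow> \<bar>u a - u b\<bar> \<le> L * dist a b"
    using assms p unfolding loc_lipschitz_on_def by blast
  define d where "d = min r (e / (\<bar>L\<bar> + 1))"
  have d: "d > 0" using r e by (auto simp: d_def)
  show "\<exists>d>0. \<forall>x'\<in>D. dist x' p < d \<longrightarrow> dist (u x') (u p) < e"
  proof (intro exI[of _ d] conjI ballI impI d)
    fix x' assume x': "x' \<in> D" "dist x' p < d"
    have "dist x' p * (\<bar>L\<bar> + 1) < e"
      using x'(2) by (simp add: d_def pos_less_divide_eq)
    moreover have "L * dist x' p \<le> dist x' p * (\<bar>L\<bar> + 1)"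
      by (simp add: mult.commute[of L] mult_left_mono)
    moreover have "\<bar>u x' - u p\<bar> \<le> L * dist x' p"
      using x' p r by (intro L) (auto simp: d_def dist_commute)
    ultimately show "dist (u x') (u p) < e" by (simp add: dist_real_def)
  qed
qed

section \<open>Separable test functions with minimisers in compact sets\<close>

lemma diff21_separable:
  assumes f: "\<And>x. (f has_real_derivative f' x) (at x)"
    and f': "\<And>x. (f' has_real_derivative f'' x) (at x)"
    and f'': "continuous_on UNIV f''"
    and g: "\<And>c. (g has_real_derivative g' c) (at c)"
    and g': "continuous_on UNIV g'"
  shows "diff21 clo chi (\<lambda>(x, c). f x + g c) (\<lambda>(x, c). f' x) (\<lambda>(x, c). g' c) (\<lambda>(x, c). f'' x)"
  unfolding diff21_def Let_def
proof (intro conjI ballI allI impI)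
  fix p :: "real \<times> real"
  have 1: "((\<lambda>p. f (fst p)) has_derivative (\<lambda>h. f' (fst p) * fst h)) (at p within {0..} \<times> {clo..<chi})"
    by (rule has_derivative_compose[OF has_derivative_fst[OF has_derivative_ident]
          f[unfolded has_field_derivative_def]])
  have 2: "((\<lambda>p. g (snd p)) has_derivative (\<lambda>h. g' (snd p) * snd h)) (at p within {0..} \<times> {clo..<chi})"
    by (rule has_derivative_compose[OF has_derivative_snd[OF has_derivative_ident]
          g[unfolded has_field_derivative_def]])
  show "((\<lambda>(x, c). f x + g c) has_derivative
     (\<lambda>(h, k). (case p of (x, c) \<Rightarrow> f' x) * h + (case p of (x, c) \<Rightarrow> g' c) * k))
       (at p within {0..} \<times> {clo..<chi})"
    using has_derivative_add[OF 1 2] by (simp add: case_prod_unfold)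
next
  have "continuous_on UNIV f'"
    using f' by (meson DERIV_continuous_on has_field_derivative_at_within)
  then show "continuous_on ({0..} \<times> {clo..<chi}) (\<lambda>(x, c). f' x)"
    by (auto simp: case_prod_unfold intro!: continuous_on_compose2[of UNIV f'] continuous_intros)
  show "continuous_on ({0..} \<times> {clo..<chi}) (\<lambda>(x, c). g' c)"
    using g' by (auto simp: case_prod_unfold intro!: continuous_on_compose2[of UNIV g'] continuous_intros)
next
  fix c x :: real
  show "((\<lambda>y. case (y, c) of (x, c) \<Rightarrow> f' x) has_real_derivative (case (x, c) of (x, c) \<Rightarrow> f'' x))
     (at x within {0..})"
    using f' by (auto intro: has_field_derivative_at_within)
next
  fix c :: real
  show "continuous_on {0..} (\<lambda>y. case (y, c) of (x, c) \<Rightarrow> f'' x)"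
    using f'' by (auto intro: continuous_on_subset)
qed

text \<open>The definition asks for a global minimum of the difference on a domain that is neither
  bounded nor closed at \<open>chi\<close>. The hypothesis on the complement of \<open>K\<close>
  says that no point there beats the reference point \<open>(x0, c0)\<close>, so a minimiser over
  the compact set \<open>K\<close> is global. It also inherits the bound by the value at the
  reference point.\<close>

lemma visc_super_separable_test:
  assumes vs: "visc_super mu sig q clo chi W"
    and f: "\<And>x. (f has_real_derivative f' x) (at x)"
    and f': "\<And>x. (f' has_real_derivative f'' x) (at x)"
    and f'': "continuous_on UNIV f''"
    and g: "\<And>c. (g has_real_derivative g' c) (at c)"
    and g': "continuous_on UNIV g'"
    and K: "compact K" "K \<subseteq> {0<..} \<times> {clo..<chi}" "(x0, c0) \<in> K"
    and out: "\<And>x c. 0 \<le> x \<Longrightarrow> clo \<le> c \<Longrightarrow> c < chi \<Longrightarrow> (x, c) \<notin> K \<Longrightarrow>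
      W (x0, c0) - (f x0 + g c0) \<le> W (x, c) - (f x + g c)"
  obtains x c where "(x, c) \<in> K" "W (x, c) - (f x + g c) \<le> W (x0, c0) - (f x0 + g c0)"
    "gen_op mu sig q c (W (x, c)) (f' x) (f'' x) \<le> 0" "g' c \<le> 0"
proof -
  let ?D = "{0..} \<times> {clo..<chi}"
  have KD: "K \<subseteq> ?D" using K(2) by force
  have "continuous_on K W"
    using vs KD by (auto simp: visc_super_def intro: continuous_on_subset loc_lipschitz_on_imp_continuous_on)
  moreover have "continuous_on UNIV f" "continuous_on UNIV g"
    using f g by (meson DERIV_continuous_on has_field_derivative_at_within)+
  ultimately have "continuous_on K (\<lambda>p. W p - (f (fst p) + g (snd p)))"
    by (auto intro!: continuous_intros continuous_on_compose2[of UNIV f] continuous_on_compose2[of UNIV g])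
  then obtain m where m: "m \<in> K"
    and mmin: "\<And>p. p \<in> K \<Longrightarrow> W m - (f (fst m) + g (snd m)) \<le> W p - (f (fst p) + g (snd p))"
    using continuous_attains_inf[OF K(1)] K(3) by blast
  obtain x c where xc: "m = (x, c)" by (cases m)
  have pos: "0 < x" "clo \<le> c" "c < chi" using m K(2) xc by auto
  \<comment> \<open>A vertical shift makes the test function touch W at the minimiser; it leaves all
    derivatives unchanged and is absorbed into the part depending on c.\<close>
  define k where "k = W (x, c) - (f x + g c)"
  have le0: "k \<le> W (x0, c0) - (f x0 + g c0)"
    using mmin[OF K(3)] by (simp add: xc k_def)
  have "diff21 clo chi (\<lambda>(x, c). f x + (g c + k)) (\<lambda>(x, c). f' x) (\<lambda>(x, c). g' c) (\<lambda>(x, c). f'' x)"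
    using g by (intro diff21_separable f f' f'' g') (auto intro!: derivative_eq_intros)
  moreover have "W p - (case p of (x, c) \<Rightarrow> f x + (g c + k)) \<ge> W (x, c) - (f x + (g c + k))"
    if "p \<in> ?D" for p
    using that mmin[of p] out[of "fst p" "snd p"] le0
    by (cases "p \<in> K") (auto simp: xc k_def split: prod.splits)
  ultimately have "max (gen_op mu sig q c (W (x, c)) (f' x) (f'' x)) (g' c) \<le> 0"
    using vs[unfolded visc_super_def, THEN conjunct2, rule_format, of x c
        "\<lambda>(x, c). f x + (g c + k)" "\<lambda>(x, c). f' x" "\<lambda>(x, c). g' c" "\<lambda>(x, c). f'' x"] pos
    by (simp add: k_def)
  then show thesis using that[of x c] m le0 by (auto simp: xc k_def)
qed

text \<open>One-sided penalties that vanish identically on one side. The square is smooth enough in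
  c, where one continuous derivative is required; the cube serves in x, where two are.\<close>

lemma max0_power_derivs:
  fixes a :: real
  shows "((\<lambda>x. (max 0 (x - a))\<^sup>2) has_real_derivative 2 * max 0 (x - a)) (at x)"
    and "((\<lambda>x. (max 0 (x - a))^3) has_real_derivative 3 * (max 0 (x - a))\<^sup>2) (at x)"
proof -
  have *: "((\<lambda>x. (max 0 (x - a))^Suc (Suc n)) has_real_derivative real (Suc (Suc n)) * (max 0 (x - a))^Suc n) (at x)" for n
  proof -
    consider "x < a" | "x > a" | "x = a" by linarith
    then show ?thesis
    proof cases
      case 1
      have "((\<lambda>x. 0) has_real_derivative real (Suc (Suc n)) * (max 0 (x - a))^Suc n) (at x)"
        using 1 by simp
      then show ?thesis
        by (rule DERIV_cong_ev[THEN iffD1, rotated -1, OF _ refl _ refl])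
          (use 1 in \<open>auto intro!: eventually_mono[OF eventually_nhds_in_open[of "{..<a}" x]]\<close>)
    next
      case 2
      have "((\<lambda>x. (x - a)^Suc (Suc n)) has_real_derivative real (Suc (Suc n)) * (max 0 (x - a))^Suc n) (at x)"
        using 2 DERIV_power[OF DERIV_diff[OF DERIV_ident DERIV_const[of a]], where n = "Suc (Suc n)" and x = x and s = UNIV]
        by simp
      then show ?thesis
        by (rule DERIV_cong_ev[THEN iffD1, rotated -1, OF _ refl _ refl])
          (use 2 in \<open>auto intro!: eventually_mono[OF eventually_nhds_in_open[of "{a<..}" x]]\<close>)
    next
      case 3
      have "((\<lambda>h. (max 0 h)^Suc (Suc n) / h) \<longlongrightarrow> 0) (at (0::real))"
      proof (rule tendsto_sandwich)
        show "\<forall>\<^sub>F h in at (0::real). - (abs h ^ Suc n) \<le> (max 0 h)^Suc (Suc n) / h"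
          "\<forall>\<^sub>F h in at (0::real). (max 0 h)^Suc (Suc n) / h \<le> abs h ^ Suc n"
          by (auto simp: max_def divide_simps intro!: always_eventually mult_nonpos_nonpos mult_nonpos_nonneg)
      qed (auto intro!: tendsto_eq_intros)
      then show ?thesis using 3 by (simp add: DERIV_def)
    qed
  qed
  show "((\<lambda>x. (max 0 (x - a))\<^sup>2) has_real_derivative 2 * max 0 (x - a)) (at x)"
    using *[of 0] by (simp add: numeral_2_eq_2)
  show "((\<lambda>x. (max 0 (x - a))^3) has_real_derivative 3 * (max 0 (x - a))\<^sup>2) (at x)"
    using *[of 1] by (simp add: numeral_2_eq_2 numeral_3_eq_3)
qed


text \<open>If W increased from \<open>c1\<close> to \<open>c2\<close>, a test function with a small
  positive slope \<open>s\<close> in c would touch W at some point with c at most \<open>c2\<close>,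
  against the sign condition on the c-derivative. The penalty in c starts only beyond
  \<open>c2\<close>, so it does not disturb the slope where contact occurs.\<close>

lemma visc_super_antimono:
  assumes vs: "visc_super mu sig q clo chi W"
    and nn: "\<And>x c. 0 \<le> x \<Longrightarrow> clo \<le> c \<Longrightarrow> c < chi \<Longrightarrow> 0 \<le> W (x, c)"
    and x0: "0 < x0" and c: "clo \<le> c1" "c1 \<le> c2" "c2 < chi"
  shows "W (x0, c2) \<le> W (x0, c1)"
proof (rule ccontr)
  assume "\<not> ?thesis"
  then have less: "W (x0, c1) < W (x0, c2)" by simp
  define w1 w2 where "w1 = W (x0, c1)" and "w2 = W (x0, c2)"
  have w: "w1 < w2" "0 \<le> w1" using less nn[of x0 c1] x0 c by (auto simp: w1_def w2_def)
  have c12: "c1 < c2" using less c by (cases "c1 = c2") auto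
  \<comment> \<open>Over the whole range up to \<open>chi\<close> the tilt rises by half of the gap
    \<open>w2 - w1\<close>; the other half is left for the oscillation of W near
    \<open>(x0, c2)\<close>.\<close>
  define s where "s = (w2 - w1) / (2 * (chi - c1))"
  have s: "s > 0" "s * (chi - c1) = (w2 - w1) / 2" using w c c12 by (auto simp: s_def divide_simps)
  have s_le: "s * (y - c1) \<le> (w2 - w1) / 2" if "y < chi" for y
    using mult_left_mono[of "y - c1" "chi - c1" s] s that by simp
  have "continuous_on ({0..} \<times> {clo..<chi}) W"
    using vs by (auto simp: visc_super_def intro: loc_lipschitz_on_imp_continuous_on)
  from this[unfolded continuous_on_iff, rule_format, of "(x0, c2)" "(w2 - w1) / 2"]
  obtain r where r: "r > 0"
    and rW: "\<And>p. p \<in> {0..} \<times> {clo..<chi} \<Longrightarrow> dist p (x0, c2) < r \<Longrightarrow> dist (W p) (W (x0, c2)) < (w2 - w1) / 2"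
    using x0 c w by auto
  define d where "d = min (x0 / 2) (r / 3)"
  have d: "0 < d" "d < x0" "2 * d < r" using r x0 by (auto simp: d_def)
  \<comment> \<open>At distance \<open>d\<close> the penalty alone reaches w1 + (w2 - w1) / 2, the
    largest level needed, so W \<ge> 0 suffices there.\<close>
  define N where "N = (w1 + (w2 - w1) / 2) / d\<^sup>2"
  have N: "N * d\<^sup>2 = w1 + (w2 - w1) / 2" "0 \<le> N" using d w by (auto simp: N_def)
  have N': "w1 + (w2 - w1) / 2 \<le> N * y\<^sup>2" if "d \<le> \<bar>y\<bar>" for y
    using mult_left_mono[of "d\<^sup>2" "y\<^sup>2" N] N that d abs_le_square_iff[of d y] by simp
  define K where "K = {x0 - d..x0 + d} \<times> {clo..c2}"
  define f where "f = (\<lambda>x. - N * (x - x0)\<^sup>2)"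
  define g where "g = (\<lambda>c. s * (c - c1) - N * (max 0 (c - c2))\<^sup>2)"
  obtain x c where xc: "(x, c) \<in> K" "s - N * (2 * max 0 (c - c2)) \<le> 0"
  proof (rule visc_super_separable_test[OF vs, where f = f and g = g and K = K and ?x0.0 = x0 and ?c0.0 = c1
        and f' = "\<lambda>x. - N * (2 * (x - x0))" and f'' = "\<lambda>x. - N * 2"
        and g' = "\<lambda>c. s - N * (2 * max 0 (c - c2))"])
    show "(f has_real_derivative - N * (2 * (x - x0))) (at x)" for x
      unfolding f_def by (auto intro!: derivative_eq_intros)
    show "((\<lambda>x. - N * (2 * (x - x0))) has_real_derivative - N * 2) (at x)" for x
      by (auto intro!: derivative_eq_intros)
    show "(g has_real_derivative s - N * (2 * max 0 (c - c2))) (at c)" for c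
      unfolding g_def
      by (rule derivative_eq_intros DERIV_cmult max0_power_derivs refl)+ simp
    show "compact K" unfolding K_def by (intro compact_Times compact_Icc)
    show "K \<subseteq> {0<..} \<times> {clo..<chi}" "(x0, c1) \<in> K" using d c by (auto simp: K_def)
    fix x c assume xc: "0 \<le> x" "clo \<le> c" "c < chi" "(x, c) \<notin> K"
    have W0: "0 \<le> W (x, c)" using nn xc by auto
    have lin: "s * (c - c1) \<le> (w2 - w1) / 2" using s_le xc by simp
    have "w1 + s * (c - c1) \<le> W (x, c) + N * (x - x0)\<^sup>2 + N * (max 0 (c - c2))\<^sup>2"
    proof (cases "d \<le> \<bar>x - x0\<bar> \<or> d \<le> c - c2")
      case True
      then show ?thesis
      proof
        assume "d \<le> \<bar>x - x0\<bar>"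
        moreover have "0 \<le> N * (max 0 (c - c2))\<^sup>2" using N(2) by simp
        ultimately show ?thesis using N'[of "x - x0"] lin W0 by linarith
      next
        assume "d \<le> c - c2"
        then have "d \<le> \<bar>max 0 (c - c2)\<bar>" by simp
        moreover have "0 \<le> N * (x - x0)\<^sup>2" using N(2) by simp
        ultimately show ?thesis using N'[of "max 0 (c - c2)"] lin W0 by linarith
      qed
    next
      case False
      \<comment> \<open>What remains outside \<open>K\<close> is a thin strip just above
        \<open>c2\<close> and close to \<open>x0\<close>, where continuity keeps W above the
        midpoint of \<open>w1\<close> and \<open>w2\<close>.\<close>
      then have "c > c2" using xc by (auto simp: K_def)
      have "dist (x, c) (x0, c2) \<le> \<bar>x - x0\<bar> + \<bar>c - c2\<bar>"
        using sqrt_sum_squares_le_sum_abs by (simp add: dist_prod_def dist_real_def)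
      also have "\<dots> < r" using False \<open>c > c2\<close> d by linarith
      finally have "\<bar>W (x, c) - w2\<bar> < (w2 - w1) / 2"
        using rW[of "(x, c)"] xc by (auto simp: w2_def dist_real_def)
      moreover have "0 \<le> N * (x - x0)\<^sup>2" "0 \<le> N * (max 0 (c - c2))\<^sup>2" using N(2) by simp_all
      ultimately show ?thesis using lin by argo
    qed
    then show "W (x0, c1) - (f x0 + g c1) \<le> W (x, c) - (f x + g c)"
      using c12 by (simp add: f_def g_def w1_def)
  qed (auto intro!: continuous_intros)
  then have "c \<le> c2" by (simp add: K_def)
  then show False using xc s by simp
qed

section \<open>Comparison with exponential solutions of the linear equation\<close>

lemma characteristic_roots:
  fixes sig q :: real
  assumes "0 < sig" "0 < q"
  obtains th1 th2 where "0 < th1" "th2 < 0" "sig\<^sup>2 / 2 * th1\<^sup>2 + m * th1 = q" "sig\<^sup>2 / 2 * th2\<^sup>2 + m * th2 = q"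
proof -
  define R where "R = sqrt (m\<^sup>2 + 2 * sig\<^sup>2 * q)"
  have R2: "R\<^sup>2 = m\<^sup>2 + 2 * sig\<^sup>2 * q" unfolding R_def using assms by simp
  have "\<bar>m\<bar> < R" unfolding R_def by (rule real_less_rsqrt) (use assms in auto)
  then have m: "m < R" "- m < R" by auto
  have root: "sig\<^sup>2 / 2 * (e / sig\<^sup>2)\<^sup>2 + m * (e / sig\<^sup>2) = q" if "e\<^sup>2 + 2 * m * e = 2 * sig\<^sup>2 * q" for e
  proof -
    have "sig\<^sup>2 / 2 * (e / sig\<^sup>2)\<^sup>2 + m * (e / sig\<^sup>2) = (e\<^sup>2 + 2 * m * e) / (2 * sig\<^sup>2)"
      using assms by (simp add: field_simps power2_eq_square)
    then show ?thesis using that assms by simp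
  qed
  show thesis
  proof (rule that[of "(R - m) / sig\<^sup>2" "(- R - m) / sig\<^sup>2"])
    show "0 < (R - m) / sig\<^sup>2" "(- R - m) / sig\<^sup>2 < 0"
      using m assms by (auto simp: divide_simps)
  qed (rule root, use R2 in \<open>simp add: power2_eq_square algebra_simps\<close>)+
qed

text \<open>The test function is the exact solution minus a cubic penalty outside the interval, whose
  exponential weight beats the growth of the solution at infinity.\<close>

lemma visc_super_ge_solution:
  assumes vs: "visc_super mu sig q clo chi W"
    and nn: "\<And>x c. 0 \<le> x \<Longrightarrow> clo \<le> c \<Longrightarrow> c < chi \<Longrightarrow> 0 \<le> W (x, c)"
    and q: "0 < q" and clo: "0 \<le> clo" and c0: "clo \<le> c0" "c0 < chi"
    and th: "0 < th1" "th2 < 0" "sig\<^sup>2 / 2 * th1\<^sup>2 + (mu - c0) * th1 = q"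
      "sig\<^sup>2 / 2 * th2\<^sup>2 + (mu - c0) * th2 = q"
    and ab: "0 < a" "a \<le> y" "y \<le> b"
    and h: "\<And>x. h x = c0 / q + A * exp (th1 * x) + B * exp (th2 * x)"
    and ends: "h a \<le> W (a, c0)" "h b \<le> W (b, c0)"
  shows "h y \<le> W (y, c0)"
proof (rule ccontr)
  assume "\<not> ?thesis"
  then have m: "0 < h y - W (y, c0)" by simp
  define m where "m = h y - W (y, c0)"
  note m = m[folded m_def]
  \<comment> \<open>\<open>H\<close> bounds h by a multiple of the growing exponential, which fixes
    the exponential weight and the size of the penalties below.\<close>
  define H where "H = c0 / q + \<bar>A\<bar> + \<bar>B\<bar>"
  have H: "0 \<le> H" unfolding H_def using c0 clo q by auto
  have hH: "h x \<le> H * exp (th1 * x)" if "0 \<le> x" for x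
  proof -
    have e: "1 \<le> exp (th1 * x)" "exp (th2 * x) \<le> 1"
      using th that by (auto simp: mult_nonpos_nonneg)
    have "c0 / q \<le> c0 / q * exp (th1 * x)"
      using mult_left_mono[OF e(1), of "c0 / q"] c0 clo q by simp
    moreover have "A * exp (th1 * x) \<le> \<bar>A\<bar> * exp (th1 * x)" by (simp add: mult_right_mono)
    moreover have "B * exp (th2 * x) \<le> \<bar>B\<bar> * exp (th1 * x)"
      by (rule order_trans[OF mult_right_mono[of B "\<bar>B\<bar>"] mult_left_mono]) (use e in auto)
    ultimately have "h x \<le> c0 / q * exp (th1 * x) + \<bar>A\<bar> * exp (th1 * x) + \<bar>B\<bar> * exp (th1 * x)"
      unfolding h by linarith
    then show ?thesis by (simp add: H_def distrib_right)
  qed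
  define h' where "h' = (\<lambda>x. A * th1 * exp (th1 * x) + B * th2 * exp (th2 * x))"
  define h'' where "h'' = (\<lambda>x. A * th1\<^sup>2 * exp (th1 * x) + B * th2\<^sup>2 * exp (th2 * x))"
  have h_eq: "h = (\<lambda>x. c0 / q + A * exp (th1 * x) + B * exp (th2 * x))" using h by auto
  have h_d: "(h has_real_derivative h' x) (at x)" "(h' has_real_derivative h'' x) (at x)" for x
    unfolding h'_def h''_def h_eq
    by (auto intro!: derivative_eq_intros simp: power2_eq_square algebra_simps)
  have ode: "sig\<^sup>2 / 2 * h'' x + (mu - c0) * h' x - q * h x + c0 = 0" for x
  proof -
    have "sig\<^sup>2 / 2 * h'' x + (mu - c0) * h' x - q * h x + c0 =
      (sig\<^sup>2 / 2 * th1\<^sup>2 + (mu - c0) * th1 - q) * (A * exp (th1 * x)) +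
      (sig\<^sup>2 / 2 * th2\<^sup>2 + (mu - c0) * th2 - q) * (B * exp (th2 * x))"
      using q by (simp add: h h'_def h''_def algebra_simps)
    then show ?thesis using th by simp
  qed
  have "compact (h' ` {a..b})"
    unfolding h'_def by (intro compact_continuous_image continuous_intros) auto
  then obtain H1 where H1: "\<And>x. a \<le> x \<Longrightarrow> x \<le> b \<Longrightarrow> \<bar>h' x\<bar> \<le> H1"
    by (force dest!: compact_imp_bounded simp: bounded_iff)
  have H1_nn: "0 \<le> H1" using H1[of y] ab by linarith
  have cont: "continuous_on ({0..} \<times> {clo..<chi}) (\<lambda>p. W p - h (fst p))"
  proof (intro continuous_intros)
    show "continuous_on ({0..} \<times> {clo..<chi}) W"
      using vs by (auto simp: visc_super_def intro: loc_lipschitz_on_imp_continuous_on)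
    show "continuous_on ({0..} \<times> {clo..<chi}) (\<lambda>p. h (fst p))"
      unfolding h_eq by (intro continuous_intros)
  qed
  have near: "\<exists>r>0. \<forall>x c. 0 \<le> x \<longrightarrow> clo \<le> c \<longrightarrow> c < chi \<longrightarrow> \<bar>x - z\<bar> \<le> r \<longrightarrow> \<bar>c - c0\<bar> \<le> r \<longrightarrow> - m \<le> W (x, c) - h x"
    if z: "0 \<le> z" "h z \<le> W (z, c0)" for z
  proof -
    obtain r where r: "r > 0" and rW: "\<And>p. p \<in> {0..} \<times> {clo..<chi} \<Longrightarrow> dist p (z, c0) < r \<Longrightarrow>
        dist (W p - h (fst p)) (W (z, c0) - h z) < m"
      using cont[unfolded continuous_on_iff, rule_format, of "(z, c0)" m] z c0 m by auto
    show ?thesis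
    proof (intro exI[of _ "r / 3"] conjI allI impI)
      fix x c assume xc: "0 \<le> x" "clo \<le> c" "c < chi" "\<bar>x - z\<bar> \<le> r / 3" "\<bar>c - c0\<bar> \<le> r / 3"
      have "dist (x, c) (z, c0) \<le> \<bar>x - z\<bar> + \<bar>c - c0\<bar>"
        using sqrt_sum_squares_le_sum_abs by (simp add: dist_prod_def dist_real_def)
      also have "\<dots> < r" using xc r by linarith
      finally show "- m \<le> W (x, c) - h x"
        using rW[of "(x, c)"] xc z by (auto simp: dist_real_def)
    qed (use r in auto)
  qed
  obtain ra where ra: "ra > 0" "\<And>x c. 0 \<le> x \<Longrightarrow> clo \<le> c \<Longrightarrow> c < chi \<Longrightarrow> \<bar>x - a\<bar> \<le> ra \<Longrightarrow> \<bar>c - c0\<bar> \<le> ra \<Longrightarrow> - m \<le> W (x, c) - h x"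
    using near[of a] ab ends by auto
  obtain rb where rb: "rb > 0" "\<And>x c. 0 \<le> x \<Longrightarrow> clo \<le> c \<Longrightarrow> c < chi \<Longrightarrow> \<bar>x - b\<bar> \<le> rb \<Longrightarrow> \<bar>c - c0\<bar> \<le> rb \<Longrightarrow> - m \<le> W (x, c) - h x"
    using near[of b] ab ends by auto
  \<comment> \<open>The width \<open>d\<close> serves three purposes: within \<open>ra\<close>,
    \<open>rb\<close> of the end points W - h cannot drop below \<open>- m\<close>;
    \<open>c0 + d\<close> stays below \<open>chi\<close>; and the error from evaluating the operator
    at c instead of \<open>c0\<close>, at most d * (1 + H1), stays below q * m.\<close>
  define d where "d = min (min ra rb) (min ((chi - c0) / 2) (q * m / (2 * (1 + H1))))"
  have d: "0 < d" "d \<le> ra" "d \<le> rb" "c0 + d < chi"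
  proof -
    have "0 < q * m / (2 * (1 + H1))" using q m H1_nn by simp
    then show "0 < d" using ra(1) rb(1) c0 by (simp add: d_def)
    show "d \<le> ra" "d \<le> rb" by (simp_all add: d_def)
    have "d \<le> (chi - c0) / 2" unfolding d_def by linarith
    then show "c0 + d < chi" using c0 by argo
  qed
  have d_H1: "d * (1 + H1) < q * m"
  proof -
    have "d \<le> q * m / (2 * (1 + H1))" unfolding d_def by linarith
    then have "d * (1 + H1) \<le> q * m / 2" using H1_nn by (simp add: field_simps)
    moreover have "0 < q * m" using q m by simp
    ultimately show ?thesis by linarith
  qed
  \<comment> \<open>\<open>N\<close> brings f down to at most 0 once x is farther than
    \<open>d\<close> from the interval; \<open>N2\<close> compensates the maximum of f once c is
    farther than \<open>d\<close> from \<open>c0\<close>. In both cases W \<ge> 0 finishes the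
    comparison.\<close>
  define N where "N = H / d^3"
  have N: "0 \<le> N" "N * d^3 = H" using H d by (auto simp: N_def)
  define N2 where "N2 = H * exp (th1 * (b + d)) / d\<^sup>2"
  have N2: "0 \<le> N2" "N2 * d\<^sup>2 = H * exp (th1 * (b + d))" using H d by (auto simp: N2_def)
  \<comment> \<open>The left penalty is the right one reflected; \<open>- x - (- a)\<close> is a - x
    written so that the chain rule applies to \<open>max0_power_derivs\<close>.\<close>
  define r where "r = (\<lambda>x. (max 0 (x - b))^3 + (max 0 (- x - (- a)))^3)"
  define r' where "r' = (\<lambda>x. 3 * (max 0 (x - b))\<^sup>2 - 3 * (max 0 (- x - (- a)))\<^sup>2)"
  define r'' where "r'' = (\<lambda>x. 6 * max 0 (x - b) + 6 * max 0 (- x - (- a)))"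
  have r_d: "(r has_real_derivative r' x) (at x)" "(r' has_real_derivative r'' x) (at x)" for x
  proof -
    note left = DERIV_chain2[OF max0_power_derivs(1)[of "-a" "-x"] DERIV_minus[OF DERIV_ident]]
      DERIV_chain2[OF max0_power_derivs(2)[of "-a" "-x"] DERIV_minus[OF DERIV_ident]]
    show "(r has_real_derivative r' x) (at x)"
      using DERIV_add[OF max0_power_derivs(2)[of b x] left(2)[of UNIV]] by (simp add: r_def r'_def)
    show "(r' has_real_derivative r'' x) (at x)"
      using DERIV_diff[OF DERIV_cmult[OF max0_power_derivs(1)[of b x], of 3] DERIV_cmult[OF left(1)[of UNIV], of 3]]
      by (simp add: r''_def r'_def)
  qed
  have r_nn: "0 \<le> r x" for x by (simp add: r_def)
  have r_out: "d^3 \<le> r x" if "x < a - d \<or> b + d < x" for x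
  proof -
    have "d^3 \<le> (max 0 (x - b))^3 \<or> d^3 \<le> (max 0 (- x - (- a)))^3"
      using that d by (auto intro!: power_mono)
    then show ?thesis by (auto simp: r_def intro: add_increasing add_increasing2)
  qed
  define f where "f = (\<lambda>x. h x - N * (r x * exp (th1 * x)))"
  define f' where "f' = (\<lambda>x. h' x - N * ((r' x + th1 * r x) * exp (th1 * x)))"
  define f'' where "f'' = (\<lambda>x. h'' x - N * ((r'' x + 2 * th1 * r' x + th1\<^sup>2 * r x) * exp (th1 * x)))"
  define g where "g = (\<lambda>c. - N2 * (c - c0)\<^sup>2)"
  define K where "K = {a..b} \<times> {max clo (c0 - d)..c0 + d}"
  have f_le_h: "f x \<le> h x" for x using N r_nn by (simp add: f_def)
  have f_out: "f x \<le> 0" if "x < a - d \<or> b + d < x" "0 \<le> x" for x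
  proof -
    have "H * exp (th1 * x) \<le> N * (r x * exp (th1 * x))"
      using mult_left_mono[OF r_out[OF that(1)], of N] N by (simp add: mult.assoc[symmetric])
    then show ?thesis using hH[OF that(2)] unfolding f_def by linarith
  qed
  obtain x c where xc: "(x, c) \<in> K" "W (x, c) - (f x + g c) \<le> W (y, c0) - (f y + g c0)"
    "gen_op mu sig q c (W (x, c)) (f' x) (f'' x) \<le> 0"
  proof (rule visc_super_separable_test[OF vs, where f = f and g = g and K = K and ?x0.0 = y and ?c0.0 = c0
        and f' = f' and f'' = f'' and g' = "\<lambda>c. - N2 * (2 * (c - c0))"])
    show "(f has_real_derivative f' x) (at x)" for x
      unfolding f_def f'_def by (auto intro!: derivative_eq_intros h_d r_d simp: algebra_simps)
    show "(f' has_real_derivative f'' x) (at x)" for x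
      unfolding f'_def f''_def by (auto intro!: derivative_eq_intros h_d r_d simp: algebra_simps power2_eq_square)
    show "continuous_on UNIV f''"
      unfolding f''_def h''_def r''_def r'_def r_def by (intro continuous_intros)
    show "(g has_real_derivative - N2 * (2 * (c - c0))) (at c)" for c
      unfolding g_def by (auto intro!: derivative_eq_intros)
    show "compact K" unfolding K_def by (intro compact_Times compact_Icc)
    show "K \<subseteq> {0<..} \<times> {clo..<chi}" "(y, c0) \<in> K" using d c0 ab by (auto simp: K_def)
    have y0: "W (y, c0) - (f y + g c0) = - m"
      using ab by (simp add: f_def g_def r_def m_def)
    fix x c assume xc: "0 \<le> x" "clo \<le> c" "c < chi" "(x, c) \<notin> K"
    have W0: "0 \<le> W (x, c)" using nn xc by auto
    have g0: "g c \<le> 0" using N2 by (simp add: g_def)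
    have "- m \<le> W (x, c) - (f x + g c)"
    proof (cases "\<bar>c - c0\<bar> \<le> d")
      case False
      have "f x \<le> H * exp (th1 * (b + d))"
      proof (cases "b + d < x")
        case True
        then have "f x \<le> 0" using f_out xc by auto
        also have "\<dots> \<le> H * exp (th1 * (b + d))" using H by simp
        finally show ?thesis .
      next
        case False
        have "f x \<le> H * exp (th1 * x)" using f_le_h hH xc order_trans by blast
        also have "\<dots> \<le> H * exp (th1 * (b + d))" using False th H by (intro mult_left_mono) auto
        finally show ?thesis .
      qed
      moreover have "N2 * d\<^sup>2 \<le> N2 * (c - c0)\<^sup>2"
        using False N2(1) d(1) abs_le_square_iff[of d "c - c0"] by (intro mult_left_mono) auto
      ultimately show ?thesis using N2 W0 m by (simp add: g_def)
    next
      case True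
      then have x_out: "x < a \<or> b < x" using xc by (auto simp: K_def)
      show ?thesis
      proof (cases "x < a - d \<or> b + d < x")
        case True
        then have "f x \<le> 0" using f_out xc by auto
        then show ?thesis using W0 g0 m by simp
      next
        case False
        then have "\<bar>x - a\<bar> \<le> ra \<or> \<bar>x - b\<bar> \<le> rb" using x_out d(2,3) by linarith
        moreover have "\<bar>c - c0\<bar> \<le> ra" "\<bar>c - c0\<bar> \<le> rb" using \<open>\<bar>c - c0\<bar> \<le> d\<close> d(2,3) by linarith+
        ultimately have "- m \<le> W (x, c) - h x"
          using ra(2)[of x c] rb(2)[of x c] xc(1-3) by blast
        then show ?thesis using f_le_h[of x] g0 by simp
      qed
    qed
    then show "W (y, c0) - (f y + g c0) \<le> W (x, c) - (f x + g c)" by (simp add: y0)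
  qed (auto intro!: continuous_intros)
  \<comment> \<open>On \<open>K\<close> the penalty in x and its two derivatives vanish, so the
    operator of level c acts on h itself. Since W (x, c) lies at least m below h x, the zero-order
    term gains q * m over the exact equation for h, more than the change from \<open>c0\<close> to c
    can absorb.\<close>
  have x_in: "a \<le> x" "x \<le> b" and c_in: "\<bar>c - c0\<bar> \<le> d" using xc by (auto simp: K_def)
  have "f x = h x" "f' x = h' x" "f'' x = h'' x" "f y = h y"
    using x_in ab by (auto simp: f_def f'_def f''_def r_def r'_def r''_def)
  moreover have "g c \<le> 0" "g c0 = 0" using N2 by (auto simp: g_def)
  ultimately have "W (x, c) \<le> h x - m" and L: "sig\<^sup>2 / 2 * h'' x + (mu - c) * h' x - q * W (x, c) + c \<le> 0"
    using xc(2,3) by (auto simp: m_def gen_op_def)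
  then have "q * W (x, c) \<le> q * (h x - m)" using q by simp
  moreover have "(mu - c) * h' x = (mu - c0) * h' x - (c - c0) * h' x" by (simp add: algebra_simps)
  moreover have "q * (h x - m) = q * h x - q * m" by (simp add: algebra_simps)
  ultimately have "q * m \<le> (c - c0) * h' x - (c - c0)"
    using L ode[of x] by linarith
  also have "\<dots> \<le> \<bar>c - c0\<bar> * \<bar>h' x\<bar> + \<bar>c - c0\<bar>"
    using abs_ge_self[of "(c - c0) * h' x"] abs_ge_minus_self[of "c - c0"] unfolding abs_mult by linarith
  also have "\<dots> \<le> d * H1 + d"
    using mult_mono[OF c_in H1[OF x_in]] c_in d by simp
  finally show False using d_H1 by (simp add: algebra_simps)
qed

text \<open>In the variable \<open>exp ((th1 - th2) * x)\<close> the solutions of the equation are affine functions up to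
  the factor \<open>exp (th2 * x)\<close>, so that comparison with solutions is concavity and a supporting line
  becomes a solution lying above \<open>W\<close> on the whole half line.\<close>

lemma visc_super_supporting_solution:
  assumes vs: "visc_super mu sig q clo chi W"
    and nn: "\<And>x c. 0 \<le> x \<Longrightarrow> clo \<le> c \<Longrightarrow> c < chi \<Longrightarrow> 0 \<le> W (x, c)"
    and q: "0 < q" and clo: "0 \<le> clo" and c0: "clo \<le> c0" "c0 < chi"
    and th: "0 < th1" "th2 < 0" "sig\<^sup>2 / 2 * th1\<^sup>2 + (mu - c0) * th1 = q"
      "sig\<^sup>2 / 2 * th2\<^sup>2 + (mu - c0) * th2 = q"
    and x0: "0 < x0"
  obtains a b where "W (x0, c0) = c0 / q + a + b"
    "\<And>z. - x0 < z \<Longrightarrow> W (x0 + z, c0) \<le> c0 / q + a * exp (th1 * z) + b * exp (th2 * z)"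
proof -
  define k where "k = th1 - th2"
  have k: "0 < k" using th by (simp add: k_def)
  \<comment> \<open>\<open>X\<close> inverts the substitution z = exp (k * x), so x > 0 becomes z >
    1. \<open>G\<close> is W minus the particular solution \<open>c0 / q\<close>, divided by exp
    (th2 * x); chords of \<open>G\<close> correspond to solutions with coefficients \<open>A\<close>
    and \<open>B\<close>.\<close>
  define X where "X = (\<lambda>z. ln z / k)"
  define G where "G = (\<lambda>z. exp (- th2 * X z) * (W (X z, c0) - c0 / q))"
  have X: "0 < X z" "exp (th1 * X z) = z * exp (th2 * X z)" if "1 < z" for z
  proof -
    show "0 < X z" using that k by (simp add: X_def)
    have "th1 * X z = k * X z + th2 * X z" by (simp add: k_def algebra_simps)
    moreover have "exp (k * X z) = z" using that k by (simp add: X_def)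
    ultimately show "exp (th1 * X z) = z * exp (th2 * X z)" by (simp add: exp_add)
  qed
  have WG: "W (X z, c0) = c0 / q + exp (th2 * X z) * G z" for z
    by (simp add: G_def mult.assoc[symmetric] exp_add[symmetric])
  have "convex_on {1<..} (\<lambda>z. - G z)"
  proof (rule convex_on_linorderI)
    fix t z1 z2 :: real
    assume t: "0 < t" "t < 1" and z: "z1 \<in> {1<..}" "z2 \<in> {1<..}" "z1 < z2"
    define z3 where "z3 = (1 - t) * z1 + t * z2"
    have z3: "z1 < z3" "z3 < z2"
    proof -
      have "0 < t * (z2 - z1)" using t z by simp
      also have "t * (z2 - z1) = z3 - z1" by (simp add: z3_def algebra_simps)
      finally show "z1 < z3" by simp
      have "0 < (1 - t) * (z2 - z1)" using t z by simp
      also have "(1 - t) * (z2 - z1) = z2 - z3" by (simp add: z3_def algebra_simps)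
      finally show "z3 < z2" by simp
    qed
    define A where "A = (G z2 - G z1) / (z2 - z1)"
    define B where "B = G z1 - A * z1"
    have AB1: "A * z1 + B = G z1" by (simp add: B_def)
    have "A * (z2 - z1) = G z2 - G z1" using z by (simp add: A_def)
    then have AB2: "A * z2 + B = G z2" by (simp add: B_def algebra_simps)
    have AB3: "A * z3 + B = (1 - t) * G z1 + t * G z2"
      by (simp add: AB1[symmetric] AB2[symmetric] z3_def algebra_simps)
    define h where "h = (\<lambda>x. c0 / q + A * exp (th1 * x) + B * exp (th2 * x))"
    have hX: "h (X z) = c0 / q + exp (th2 * X z) * (A * z + B)" if "1 < z" for z
      using X(2)[OF that] by (simp add: h_def algebra_simps)
    have "h (X z3) \<le> W (X z3, c0)"
    proof (rule visc_super_ge_solution[OF vs nn q clo c0 th, of "X z1" "X z3" "X z2" h A B])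
      show "h (X z1) \<le> W (X z1, c0)" "h (X z2) \<le> W (X z2, c0)"
        using z AB1 AB2 by (auto simp: hX WG)
      show "X z1 \<le> X z3" "X z3 \<le> X z2"
        using z3 z k by (auto simp: X_def intro!: divide_right_mono)
      show "0 < X z1" using X z by simp
    qed (simp_all add: h_def)
    then have "A * z3 + B \<le> G z3" using z z3 by (simp add: hX WG)
    then show "- G ((1 - t) *\<^sub>R z1 + t *\<^sub>R z2) \<le> (1 - t) * - G z1 + t * - G z2"
      using AB3 by (simp add: z3_def)
  qed simp
  moreover define z0 where "z0 = exp (k * x0)"
  moreover have z0: "1 < z0" using k x0 by (simp add: z0_def)
  \<comment> \<open>The infimum of the slopes of \<open>- G\<close> from \<open>z0\<close> to points
    on its right, that is, its right derivative, which is a subgradient.\<close>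
  moreover define S where "S = Inf ((\<lambda>t. (- G z0 - - G t) / (z0 - t)) ` ({z0<..} \<inter> {1<..}))"
  ultimately have sup: "- G z \<ge> - G z0 + S * (z - z0)" if "1 < z" for z
    using that unfolding S_def by (intro convex_le_Inf_differential) (auto simp: interior_open)
  have Xz0: "X z0 = x0" using k by (simp add: X_def z0_def)
  show thesis
  \<comment> \<open>The supporting line, turned back into exponentials and recentred at
    \<open>x0\<close>, which accounts for the factors exp (th1 * x0) and exp (th2 * x0).\<close>
  proof (rule that[of "- S * exp (th1 * x0)" "(G z0 + S * z0) * exp (th2 * x0)"])
    show "W (x0, c0) = c0 / q + - S * exp (th1 * x0) + (G z0 + S * z0) * exp (th2 * x0)"
      using WG[of z0] X(2)[OF z0] by (simp add: Xz0 algebra_simps)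
    fix y assume y: "- x0 < y"
    define z where "z = exp (k * (x0 + y))"
    have z: "1 < z" using y k by (simp add: z_def)
    have Xz: "X z = x0 + y" using k by (simp add: X_def z_def)
    have "G z \<le> - S * z + (G z0 + S * z0)" using sup[OF z] by (simp add: algebra_simps)
    then have "exp (th2 * (x0 + y)) * G z \<le> exp (th2 * (x0 + y)) * (- S * z + (G z0 + S * z0))"
      by (intro mult_left_mono) auto
    also have "\<dots> = - S * exp (th1 * (x0 + y)) + (G z0 + S * z0) * exp (th2 * (x0 + y))"
      using X(2)[OF z] by (simp add: Xz algebra_simps)
    finally show "W (x0 + y, c0) \<le> c0 / q + - S * exp (th1 * x0) * exp (th1 * y) + (G z0 + S * z0) * exp (th2 * x0) * exp (th2 * y)"
      using WG[of z] by (simp add: Xz exp_add distrib_left mult.assoc)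
  qed
qed

section \<open>The Gaussian one-step inequality\<close>

text \<open>Completing the square: exponential tilting moves the mean of the Gaussian to r *
  s^2.\<close>

lemma normal_mgf:
  assumes "0 < s"
  shows "has_bochner_integral lborel (\<lambda>b. normal_density 0 s b * exp (r * b)) (exp (r\<^sup>2 * s\<^sup>2 / 2))"
proof -
  have "normal_density 0 s b * exp (r * b) = exp (r\<^sup>2 * s\<^sup>2 / 2) * normal_density (r * s\<^sup>2) s b" for b
  proof -
    have "- (b - 0)\<^sup>2 / (2 * s\<^sup>2) + r * b = r\<^sup>2 * s\<^sup>2 / 2 + - (b - r * s\<^sup>2)\<^sup>2 / (2 * s\<^sup>2)"
      using assms by (simp add: field_simps power2_eq_square)
    then show ?thesis by (simp add: normal_density_def exp_add[symmetric])
  qed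
  moreover have "has_bochner_integral lborel (\<lambda>b. exp (r\<^sup>2 * s\<^sup>2 / 2) * normal_density (r * s\<^sup>2) s b) (exp (r\<^sup>2 * s\<^sup>2 / 2) * 1)"
    using assms by (intro has_bochner_integral_mult_right)
      (auto simp: has_bochner_integral_iff integral_normal_density integrable_normal_density)
  ultimately show ?thesis by simp
qed

text \<open>The exponent is t times the characteristic polynomial at r. At the roots
  \<open>th1\<close> and \<open>th2\<close> it equals q * t, so the discount factor cancels it
  exactly.\<close>

lemma normal_drift_mgf:
  assumes "0 < t"
  shows "has_bochner_integral lborel (\<lambda>b. normal_density 0 (sqrt t) b * exp (r * (m * t + sig * b)))
     (exp (t * (sig\<^sup>2 / 2 * r\<^sup>2 + m * r)))"
proof -
  have "has_bochner_integral lborel (\<lambda>b. exp (r * (m * t)) * (normal_density 0 (sqrt t) b * exp ((r * sig) * b)))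
     (exp (r * (m * t)) * exp ((r * sig)\<^sup>2 * (sqrt t)\<^sup>2 / 2))"
    using assms by (intro has_bochner_integral_mult_right normal_mgf) auto
  moreover have "exp (r * (m * t)) * (normal_density 0 (sqrt t) b * exp ((r * sig) * b))
      = normal_density 0 (sqrt t) b * exp (r * (m * t + sig * b))" for b
    by (simp add: distrib_left exp_add mult.assoc)
  moreover have "exp (r * (m * t)) * exp ((r * sig)\<^sup>2 * (sqrt t)\<^sup>2 / 2) = exp (t * (sig\<^sup>2 / 2 * r\<^sup>2 + m * r))"
    using assms by (simp add: exp_add[symmetric] algebra_simps power_mult_distrib)
  ultimately show ?thesis by simp
qed

text \<open>Division by exp (th1 * z) leaves only a as z grows. Applied to a supporting solution,
  which stays above W \<ge> 0, this controls the sign of the growing part.\<close>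

lemma ge_0_if_exp_combination_nonneg:
  fixes a b k th1 th2 :: real
  assumes "0 < th1" "th2 < 0" "\<And>z. 0 < z \<Longrightarrow> 0 \<le> k + a * exp (th1 * z) + b * exp (th2 * z)"
  shows "0 \<le> a"
proof (rule tendsto_lowerbound)
  have "((\<lambda>z. k * exp (- th1 * z) + a + b * exp ((th2 - th1) * z)) \<longlongrightarrow> k * 0 + a + b * 0) at_top"
    using assms(1,2)
    by (intro tendsto_intros filterlim_compose[OF exp_at_bot] filterlim_tendsto_neg_mult_at_bot[OF tendsto_const _ filterlim_ident]) auto
  then show "((\<lambda>z. k * exp (- th1 * z) + a + b * exp ((th2 - th1) * z)) \<longlongrightarrow> a) at_top" by simp
  show "\<forall>\<^sub>F z in at_top. 0 \<le> k * exp (- th1 * z) + a + b * exp ((th2 - th1) * z)"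
    using eventually_gt_at_top[of 0]
  proof eventually_elim
    case (elim z)
    have "0 \<le> exp (- th1 * z) * (k + a * exp (th1 * z) + b * exp (th2 * z))"
      using assms(3)[OF elim] by simp
    also have "\<dots> = k * exp (- th1 * z) + a * exp (- th1 * z + th1 * z) + b * exp (- th1 * z + th2 * z)"
      unfolding exp_add by (simp add: algebra_simps)
    finally show ?case by (simp add: algebra_simps)
  qed
qed simp

text \<open>The supporting solution through the starting point is preserved exactly by the discounted Gaussian
  transition; the only loss comes from the event that the shifted process leaves the half line in
  one step, and it is superpolynomially small in the step size.\<close>

lemma visc_super_one_step:
  assumes vs: "visc_super mu sig q clo chi W"
    and nn: "\<And>x c. 0 \<le> x \<Longrightarrow> clo \<le> c \<Longrightarrow> c < chi \<Longrightarrow> 0 \<le> W (x, c)"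
    and bd: "\<And>x c. 0 \<le> x \<Longrightarrow> clo \<le> c \<Longrightarrow> c < chi \<Longrightarrow> W (x, c) \<le> chi / q"
    and q: "0 < q" and sig: "0 < sig" and clo: "0 \<le> clo" and d: "clo \<le> d" "d < chi"
    and eps: "0 < eps"
  obtains K where "0 \<le> K" "\<And>x t. 0 \<le> x \<Longrightarrow> 0 < t \<Longrightarrow> t \<le> 1 \<Longrightarrow>
      ennreal (d * (1 - exp (- q * t)) / q) + ennreal (exp (- q * t)) *
        (\<integral>\<^sup>+ b. ennreal (normal_density 0 (sqrt t) b) *
           ennreal (if 0 \<le> x + ((mu - d) * t + sig * b) then W (x + ((mu - d) * t + sig * b) + eps, d) else 0) \<partial>lborel)
      \<le> ennreal (W (x + eps, d)) + ennreal (K * exp (- eps / sqrt t))"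
proof -
  obtain th1 th2 where th: "0 < th1" "th2 < 0" "sig\<^sup>2 / 2 * th1\<^sup>2 + (mu - d) * th1 = q"
      "sig\<^sup>2 / 2 * th2\<^sup>2 + (mu - d) * th2 = q"
    using characteristic_roots[OF sig q] by blast
  \<comment> \<open>The supporting solution is nonnegative at displacement \<open>- eps / 2\<close>,
    which is still inside the half line. Together with a + b \<le> chi / q this gives b * D \<ge> -
    2 * (chi / q), a bound independent of x; \<open>K1\<close> is the resulting constant.\<close>
  define D where "D = exp (- th2 * (eps / 2)) - exp (- th1 * (eps / 2))"
  have D: "0 < D" using th eps by (simp add: D_def mult_neg_pos)
  define K1 where "K1 = 2 * (chi / q) / D"
  have chi: "0 \<le> chi / q" using d clo q by simp
  have K1: "0 \<le> K1" unfolding K1_def by (rule divide_nonneg_pos) (use chi D in linarith)+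
  define E where "E = exp (sig\<^sup>2 / 2 * (\<bar>th2\<bar> + 1)\<^sup>2 + \<bar>mu - d\<bar> * (\<bar>th2\<bar> + 1))"
  show thesis
  proof (rule that[of "K1 * E"])
    show "0 \<le> K1 * E" using K1 by (simp add: E_def)
    fix x t :: real assume x: "0 \<le> x" and t: "0 < t" "t \<le> 1"
    define y where "y = x + eps"
    have y: "0 < y" "eps \<le> y" using x eps by (auto simp: y_def)
    obtain a b where ab: "W (y, d) = d / q + a + b"
      and sup: "\<And>z. - y < z \<Longrightarrow> W (y + z, d) \<le> d / q + a * exp (th1 * z) + b * exp (th2 * z)"
      using visc_super_supporting_solution[OF vs nn q clo d th y(1)] by blast
    have sup0: "0 \<le> d / q + a * exp (th1 * z) + b * exp (th2 * z)" if "- y < z" for z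
      using sup[OF that] nn[of "y + z" d] that d by auto
    have a: "0 \<le> a"
      by (rule ge_0_if_exp_combination_nonneg[OF th(1,2), of "d / q" a b]) (use sup0 y in auto)
    have dq: "0 \<le> d / q" "d / q \<le> chi / q" using d clo q by (auto simp: divide_right_mono)
    have b: "- K1 \<le> b"
    proof -
      have s: "a + b \<le> chi / q" using ab bd[of y d] y d dq by simp
      have "0 \<le> d / q + a * exp (- th1 * (eps / 2)) + b * exp (- th2 * (eps / 2))"
        using sup0[of "- eps / 2"] y eps by simp
      also have "\<dots> = d / q + (a + b) * exp (- th1 * (eps / 2)) + b * D"
        by (simp add: D_def algebra_simps)
      also have "(a + b) * exp (- th1 * (eps / 2)) \<le> chi / q * 1"
        by (rule order_trans[OF mult_right_mono[OF s] mult_left_mono]) (use th eps chi in auto)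
      finally have "- (2 * (chi / q)) \<le> b * D" using dq by linarith
      then have "- (2 * (chi / q)) / D \<le> b" using D by (subst pos_divide_le_eq) auto
      then show ?thesis by (simp add: K1_def)
    qed
    \<comment> \<open>The rate of an exponential weight as in a Chernoff bound. Since t * lam^2 = 1,
      the Gaussian moment \<open>M3\<close> stays bounded by \<open>E\<close> for all t \<le> 1,
      while the weight contributes exp (- eps / sqrt t).\<close>
    define lam where "lam = 1 / sqrt t"
    have lam: "0 \<le> lam" using t by (simp add: lam_def)
    define xi where "xi = (\<lambda>b. (mu - d) * t + sig * b)"
    define F where "F = (\<lambda>b. if 0 \<le> x + xi b then W (x + xi b + eps, d) else 0)"
    \<comment> \<open>A majorant of \<open>F\<close> on the whole line: for xi \<le> - eps the
      factor exp (- lam * (eps + xi)) is at least 1, so the last term outweighs a negative b;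
      elsewhere it is merely nonnegative.\<close>
    define R where "R = (\<lambda>\<beta>. d / q + a * exp (th1 * xi \<beta>) + b * exp (th2 * xi \<beta>)
       + K1 * exp (- lam * eps) * exp ((th2 - lam) * xi \<beta>))"
    have F_nn: "0 \<le> F \<beta>" for \<beta> using nn d eps by (auto simp: F_def)
    have F_le: "F \<beta> \<le> R \<beta>" for \<beta>
    proof (cases "- y < xi \<beta>")
      case True
      have "0 \<le> K1 * exp (- lam * eps) * exp ((th2 - lam) * xi \<beta>)" using K1 by simp
      moreover have "F \<beta> \<le> d / q + a * exp (th1 * xi \<beta>) + b * exp (th2 * xi \<beta>)"
        using sup[OF True] sup0[OF True] by (auto simp: F_def y_def add_ac)
      ultimately show ?thesis by (simp add: R_def)
    next
      case False
      then have xi: "xi \<beta> \<le> - eps" using y by simp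
      then have "F \<beta> = 0" using False eps by (auto simp: F_def y_def)
      have "- b * exp (th2 * xi \<beta>) \<le> K1 * exp (th2 * xi \<beta>)" using b by (intro mult_right_mono) auto
      also have "\<dots> \<le> K1 * exp (- lam * eps + (th2 - lam) * xi \<beta>)"
        using K1 mult_left_mono[OF xi lam] by (intro mult_left_mono) (auto simp: algebra_simps)
      also have "\<dots> = K1 * exp (- lam * eps) * exp ((th2 - lam) * xi \<beta>)" unfolding exp_add by simp
      finally have "0 \<le> b * exp (th2 * xi \<beta>) + K1 * exp (- lam * eps) * exp ((th2 - lam) * xi \<beta>)" by simp
      moreover have "0 \<le> a * exp (th1 * xi \<beta>)" using a by simp
      ultimately show ?thesis using dq \<open>F \<beta> = 0\<close> unfolding R_def by linarith
    qed
    define M3 where "M3 = exp (t * (sig\<^sup>2 / 2 * (th2 - lam)\<^sup>2 + (mu - d) * (th2 - lam)))"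
    define IR where "IR = d / q * 1 + a * exp (t * q) + b * exp (t * q) + K1 * exp (- lam * eps) * M3"
    have "has_bochner_integral lborel (\<lambda>\<beta>. d / q * normal_density 0 (sqrt t) \<beta>
        + a * (normal_density 0 (sqrt t) \<beta> * exp (th1 * xi \<beta>)) + b * (normal_density 0 (sqrt t) \<beta> * exp (th2 * xi \<beta>))
        + K1 * exp (- lam * eps) * (normal_density 0 (sqrt t) \<beta> * exp ((th2 - lam) * xi \<beta>))) IR"
      unfolding IR_def xi_def M3_def
    proof (intro has_bochner_integral_add has_bochner_integral_mult_right)
      show "has_bochner_integral lborel (normal_density 0 (sqrt t)) 1"
        using t by (simp add: has_bochner_integral_iff)
    qed (rule normal_drift_mgf[OF t(1), of th1 "mu - d" sig, unfolded th(3)]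
      normal_drift_mgf[OF t(1), of th2 "mu - d" sig, unfolded th(4)]
      normal_drift_mgf[OF t(1), of "th2 - lam" "mu - d" sig])+
    moreover have "(\<lambda>\<beta>. d / q * normal_density 0 (sqrt t) \<beta>
        + a * (normal_density 0 (sqrt t) \<beta> * exp (th1 * xi \<beta>)) + b * (normal_density 0 (sqrt t) \<beta> * exp (th2 * xi \<beta>))
        + K1 * exp (- lam * eps) * (normal_density 0 (sqrt t) \<beta> * exp ((th2 - lam) * xi \<beta>)))
        = (\<lambda>\<beta>. normal_density 0 (sqrt t) \<beta> * R \<beta>)"
      by (simp add: R_def algebra_simps)
    ultimately have R_int: "has_bochner_integral lborel (\<lambda>\<beta>. normal_density 0 (sqrt t) \<beta> * R \<beta>) IR"
      by simp
    have "(\<integral>\<^sup>+ \<beta>. ennreal (normal_density 0 (sqrt t) \<beta>) * ennreal (F \<beta>) \<partial>lborel)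
        \<le> (\<integral>\<^sup>+ \<beta>. ennreal (normal_density 0 (sqrt t) \<beta> * R \<beta>) \<partial>lborel)"
      by (intro nn_integral_mono) (auto simp: ennreal_mult'[symmetric] intro!: ennreal_leI mult_left_mono F_le)
    also have "\<dots> = ennreal IR"
      using R_int F_le F_nn order_trans[OF F_nn F_le]
      by (subst nn_integral_eq_integral) (auto simp: has_bochner_integral_iff)
    finally have int_le: "(\<integral>\<^sup>+ \<beta>. ennreal (normal_density 0 (sqrt t) \<beta>) * ennreal (F \<beta>) \<partial>lborel) \<le> ennreal IR" .
    have IR_nn: "0 \<le> IR"
    proof -
      have "0 \<le> normal_density 0 (sqrt t) \<beta> * R \<beta>" for \<beta>
        using order_trans[OF F_nn F_le] by simp
      then have "0 \<le> (\<integral>\<beta>. normal_density 0 (sqrt t) \<beta> * R \<beta> \<partial>lborel)" by (rule Bochner_Integration.integral_nonneg)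
      then show ?thesis using R_int by (simp add: has_bochner_integral_iff)
    qed
    have M3: "M3 \<le> E"
    proof -
      have st: "0 < sqrt t" "sqrt t \<le> 1" "t \<le> sqrt t" "sqrt t * sqrt t = t"
        using t real_le_rsqrt[of t t] by (auto simp: power2_eq_square mult_left_le)
      have u: "sqrt t * \<bar>th2 - lam\<bar> \<le> \<bar>th2\<bar> + 1"
      proof -
        have "sqrt t * \<bar>th2 - lam\<bar> \<le> sqrt t * (\<bar>th2\<bar> + lam)"
          using st lam by (intro mult_left_mono) auto
        also have "\<dots> = sqrt t * \<bar>th2\<bar> + 1" using st by (simp add: lam_def distrib_left)
        also have "\<dots> \<le> \<bar>th2\<bar> + 1" using st by (simp add: mult_left_le_one_le)
        finally show ?thesis .
      qed
      have "t * (th2 - lam)\<^sup>2 = (sqrt t * \<bar>th2 - lam\<bar>)\<^sup>2"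
        using t by (simp add: power_mult_distrib)
      also have "\<dots> \<le> (\<bar>th2\<bar> + 1)\<^sup>2" using u st by (intro power_mono) auto
      finally have 1: "sig\<^sup>2 / 2 * (t * (th2 - lam)\<^sup>2) \<le> sig\<^sup>2 / 2 * (\<bar>th2\<bar> + 1)\<^sup>2"
        by (intro mult_left_mono) auto
      have "t * \<bar>th2 - lam\<bar> \<le> sqrt t * \<bar>th2 - lam\<bar>" using st by (intro mult_right_mono) auto
      then have "t * \<bar>th2 - lam\<bar> \<le> \<bar>th2\<bar> + 1" using u by linarith
      then have "\<bar>mu - d\<bar> * (t * \<bar>th2 - lam\<bar>) \<le> \<bar>mu - d\<bar> * (\<bar>th2\<bar> + 1)" by (intro mult_left_mono) auto
      moreover have "(mu - d) * (t * (th2 - lam)) \<le> \<bar>mu - d\<bar> * (t * \<bar>th2 - lam\<bar>)"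
        using t by (metis abs_ge_self abs_mult abs_of_pos)
      ultimately have "t * (sig\<^sup>2 / 2 * (th2 - lam)\<^sup>2 + (mu - d) * (th2 - lam)) \<le>
          sig\<^sup>2 / 2 * (\<bar>th2\<bar> + 1)\<^sup>2 + \<bar>mu - d\<bar> * (\<bar>th2\<bar> + 1)"
        using 1 by (simp add: algebra_simps)
      then show ?thesis by (simp add: M3_def E_def)
    qed
    \<comment> \<open>The reward of the step and the discounted constant d / q add up to d / q, and
      both exponentials are preserved; only the correction term is left over.\<close>
    have "d * (1 - exp (- q * t)) / q + exp (- q * t) * IR =
        d / q + a + b + exp (- q * t) * (K1 * exp (- lam * eps) * M3)"
    proof -
      have "exp (- q * t) * exp (t * q) = 1" by (simp add: exp_add[symmetric])
      then show ?thesis unfolding IR_def using q by (simp add: field_simps)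
    qed
    also have "\<dots> \<le> W (y, d) + 1 * (K1 * exp (- lam * eps) * E)"
      using ab M3 K1 q t by (intro add_mono mult_mono mult_left_mono) (auto simp: M3_def)
    also have "\<dots> = W (x + eps, d) + K1 * E * exp (- eps / sqrt t)"
      by (simp add: y_def lam_def)
    finally have fin: "d * (1 - exp (- q * t)) / q + exp (- q * t) * IR \<le> W (x + eps, d) + K1 * E * exp (- eps / sqrt t)" .
    have dnn: "0 \<le> d * (1 - exp (- q * t)) / q" using d clo q t by simp
    have Wnn: "0 \<le> W (x + eps, d)" using nn x eps d by simp
    have "ennreal (d * (1 - exp (- q * t)) / q) + ennreal (exp (- q * t)) *
        (\<integral>\<^sup>+ \<beta>. ennreal (normal_density 0 (sqrt t) \<beta>) * ennreal (F \<beta>) \<partial>lborel)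
       \<le> ennreal (d * (1 - exp (- q * t)) / q) + ennreal (exp (- q * t)) * ennreal IR"
      by (intro add_left_mono mult_left_mono int_le) auto
    also have "\<dots> = ennreal (d * (1 - exp (- q * t)) / q + exp (- q * t) * IR)"
      using dnn IR_nn by (simp add: ennreal_mult ennreal_plus)
    also have "\<dots> \<le> ennreal (W (x + eps, d) + K1 * E * exp (- eps / sqrt t))"
      by (rule ennreal_leI[OF fin])
    also have "\<dots> = ennreal (W (x + eps, d)) + ennreal (K1 * E * exp (- eps / sqrt t))"
      by (rule ennreal_plus) (use Wnn K1 in \<open>auto simp: E_def\<close>)
    finally show "ennreal (d * (1 - exp (- q * t)) / q) + ennreal (exp (- q * t)) *
        (\<integral>\<^sup>+ b. ennreal (normal_density 0 (sqrt t) b) *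
           ennreal (if 0 \<le> x + ((mu - d) * t + sig * b) then W (x + ((mu - d) * t + sig * b) + eps, d) else 0) \<partial>lborel)
      \<le> ennreal (W (x + eps, d)) + ennreal (K1 * E * exp (- eps / sqrt t))"
      unfolding F_def xi_def .
  qed
qed

section \<open>Brownian increments and the completed filtration\<close>

text \<open>\<open>std_BM\<close> provides independent increments along infinite strictly increasing
  time sequences. Sorting the given times together with 0 and T, and continuing with steps of length
  t, makes the increment after T the one with index \<open>n\<close>.\<close>

lemma finite_set_strict_mono_extension:
  fixes J :: "real set"
  assumes J: "finite J" "J \<subseteq> {0..T}" and T: "0 \<le> T" and t: "0 < t"
  obtains ts :: "nat \<Rightarrow> real" and n where "strict_mono ts" "ts 0 = 0" "ts n = T" "ts (Suc n) = T + t"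
    "\<And>s. s \<in> J \<Longrightarrow> \<exists>k\<le>n. s = ts k"
proof -
  define xs where "xs = sorted_list_of_set (insert 0 (insert T J))"
  have set: "set xs = insert 0 (insert T J)" unfolding xs_def using J by (intro set_sorted_list_of_set) auto
  have srt: "sorted_wrt (<) xs" by (simp add: xs_def)
  have ne: "xs \<noteq> []" using set by auto
  define n where "n = length xs - 1"
  have len: "length xs = Suc n" using ne by (simp add: n_def)
  have less: "xs ! i < xs ! j" if "i < j" "j \<le> n" for i j
    using sorted_wrt_nth_less[OF srt that(1)] that len by simp
  have range: "0 \<le> xs ! i" "xs ! i \<le> T" if "i \<le> n" for i
    using nth_mem[of i xs] that len J T unfolding set by auto
  have x0: "xs ! 0 = 0"
  proof -
    have "0 \<in> set xs" using set by simp
    then obtain i where "i \<le> n" "xs ! i = 0" using len by (auto simp: in_set_conv_nth less_Suc_eq_le)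
    then show ?thesis using less[of 0 i] range(1)[of 0] by (cases "i = 0") auto
  qed
  have xn: "xs ! n = T"
  proof -
    have "T \<in> set xs" using set by simp
    then obtain i where "i \<le> n" "xs ! i = T" using len by (auto simp: in_set_conv_nth less_Suc_eq_le)
    then show ?thesis using less[of i n] range(2)[of n] by (cases "i = n") auto
  qed
  define ts where "ts = (\<lambda>i. if i \<le> n then xs ! i else T + t * (real i - real n))"
  show thesis
  proof (rule that[of ts n])
    show "strict_mono ts"
      unfolding strict_mono_Suc_iff
    proof
      fix i
      consider "Suc i \<le> n" | "i = n" | "n < i" by linarith
      then show "ts i < ts (Suc i)"
        using less[of i "Suc i"] t xn by cases (auto simp: ts_def)
    qed
    show "ts 0 = 0" "ts n = T" "ts (Suc n) = T + t" using x0 xn by (auto simp: ts_def)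
    fix s assume "s \<in> J"
    then have "s \<in> set xs" using set by simp
    then obtain i where "i \<le> n" "xs ! i = s" using len by (auto simp: in_set_conv_nth less_Suc_eq_le)
    then show "\<exists>k\<le>n. s = ts k" by (auto simp: ts_def)
  qed
qed

definition cylinder :: "'a measure \<Rightarrow> (real \<Rightarrow> 'a \<Rightarrow> real) \<Rightarrow> real set \<Rightarrow> (real \<Rightarrow> real) set \<Rightarrow> 'a set" where
  "cylinder M B J S = (\<lambda>\<omega>. restrict (\<lambda>s. B s \<omega>) J) -` S \<inter> space M"

text \<open>Since B starts at 0, its values at the times in \<open>J\<close> are partial sums of the
  increments with index below \<open>n\<close>, so a cylinder event depends only on these, whereas
  the increment after T is the one with index \<open>n\<close>.\<close>

lemma cylinder_increment_indep:
  assumes BM: "std_BM M B" and J: "finite J" "J \<subseteq> {0..T}" and T: "0 \<le> T" and t: "0 < t"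
    and S: "S \<in> sets (PiM J (\<lambda>_. borel))" and A: "A \<in> sets borel"
  shows "measure M (cylinder M B J S \<inter> ((\<lambda>\<omega>. B (T + t) \<omega> - B T \<omega>) -` A \<inter> space M)) =
    measure M (cylinder M B J S) * measure M ((\<lambda>\<omega>. B (T + t) \<omega> - B T \<omega>) -` A \<inter> space M)"
proof -
  interpret prob_space M using BM by (simp add: std_BM_def)
  obtain ts :: "nat \<Rightarrow> real" and n where ts: "strict_mono ts" "ts 0 = 0" "ts n = T" "ts (Suc n) = T + t"
    and cov: "\<And>s. s \<in> J \<Longrightarrow> \<exists>k\<le>n. s = ts k"
    using finite_set_strict_mono_extension[OF J T t] by blast
  obtain k where k: "\<And>s. s \<in> J \<Longrightarrow> k s \<le> n" "\<And>s. s \<in> J \<Longrightarrow> ts (k s) = s"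
    using cov by metis
  define Z where "Z = (\<lambda>i \<omega>. B (ts (Suc i)) \<omega> - B (ts i) \<omega>)"
  have "indep_vars (\<lambda>_. borel) Z {..<Suc n}"
    using BM ts unfolding std_BM_def Z_def by auto
  then have "indep_var (PiM {..<n} (\<lambda>_. borel)) (\<lambda>\<omega>. restrict (\<lambda>i. Z i \<omega>) {..<n})
      (PiM {n} (\<lambda>_. borel)) (\<lambda>\<omega>. restrict (\<lambda>i. Z i \<omega>) {n})"
    by (rule indep_var_restrict) auto
  \<comment> \<open>Recovers the values of the path at the times in \<open>J\<close> from the
    increments.\<close>
  moreover define g where "g = (\<lambda>f. \<lambda>s\<in>J. \<Sum>i<k s. f i :: real)"
  moreover have "g \<in> PiM {..<n} (\<lambda>_. borel) \<rightarrow>\<^sub>M PiM J (\<lambda>_. borel)"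
    unfolding g_def
  proof (rule measurable_restrict)
    fix s assume "s \<in> J"
    then have "i \<in> {..<n}" if "i < k s" for i using k(1)[of s] that by auto
    then show "(\<lambda>f. \<Sum>i<k s. f i :: real) \<in> borel_measurable (PiM {..<n} (\<lambda>_. borel))"
      by (intro borel_measurable_sum[of "{..<k s}" "\<lambda>i f. f i"] measurable_component_singleton) auto
  qed
  moreover have "(\<lambda>f. f n) \<in> PiM {n} (\<lambda>_. borel :: real measure) \<rightarrow>\<^sub>M borel"
    by (rule measurable_component_singleton) simp
  moreover define S' where "S' = g -` S \<inter> space (PiM {..<n} (\<lambda>_. borel))"
  moreover define A' where "A' = (\<lambda>f. f n) -` A \<inter> space (PiM {n} (\<lambda>_. borel :: real measure))"
  ultimately have ind: "prob ((\<lambda>\<omega>. (restrict (\<lambda>i. Z i \<omega>) {..<n}, restrict (\<lambda>i. Z i \<omega>) {n})) -` (S' \<times> A') \<inter> space M) =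
    prob ((\<lambda>\<omega>. restrict (\<lambda>i. Z i \<omega>) {..<n}) -` S' \<inter> space M) *
    prob ((\<lambda>\<omega>. restrict (\<lambda>i. Z i \<omega>) {n}) -` A' \<inter> space M)"
    using S A by (intro indep_varD measurable_sets) auto
  have eq1: "restrict (\<lambda>i. Z i \<omega>) {..<n} \<in> S' \<longleftrightarrow> restrict (\<lambda>s. B s \<omega>) J \<in> S"
    if "\<omega> \<in> space M" for \<omega>
  proof -
    have "(\<Sum>i<k s. restrict (\<lambda>i. Z i \<omega>) {..<n} i) = B s \<omega>" if "s \<in> J" for s
    proof -
      have "(\<Sum>i<k s. restrict (\<lambda>i. Z i \<omega>) {..<n} i) = (\<Sum>i<k s. Z i \<omega>)"
        using k(1)[OF that] by (intro sum.cong) auto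
      also have "\<dots> = B (ts (k s)) \<omega> - B (ts 0) \<omega>"
        unfolding Z_def by (rule sum_lessThan_telescope)
      also have "\<dots> = B s \<omega>" using BM \<open>\<omega> \<in> space M\<close> k(2)[OF that] ts(2) by (simp add: std_BM_def)
      finally show ?thesis .
    qed
    then have "g (restrict (\<lambda>i. Z i \<omega>) {..<n}) = restrict (\<lambda>s. B s \<omega>) J"
      unfolding g_def by (intro restrict_ext) auto
    then show ?thesis by (simp add: S'_def space_PiM)
  qed
  have eq2: "restrict (\<lambda>i. Z i \<omega>) {n} \<in> A' \<longleftrightarrow> B (T + t) \<omega> - B T \<omega> \<in> A" for \<omega>
    using ts by (simp add: Z_def A'_def space_PiM)
  have "(\<lambda>\<omega>. (restrict (\<lambda>i. Z i \<omega>) {..<n}, restrict (\<lambda>i. Z i \<omega>) {n})) -` (S' \<times> A') \<inter> space M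
     = cylinder M B J S \<inter> ((\<lambda>\<omega>. B (T + t) \<omega> - B T \<omega>) -` A \<inter> space M)"
    using eq1 eq2 unfolding cylinder_def by blast
  moreover have "(\<lambda>\<omega>. restrict (\<lambda>i. Z i \<omega>) {..<n}) -` S' \<inter> space M = cylinder M B J S"
    using eq1 unfolding cylinder_def by blast
  moreover have "(\<lambda>\<omega>. restrict (\<lambda>i. Z i \<omega>) {n}) -` A' \<inter> space M = (\<lambda>\<omega>. B (T + t) \<omega> - B T \<omega>) -` A \<inter> space M"
    using eq2 by blast
  ultimately show ?thesis using ind by simp
qed

lemma prob_space_completion:
  assumes "prob_space M"
  shows "prob_space (completion M)"
proof
  show "emeasure (completion M) (space (completion M)) = 1"
    using prob_space.emeasure_space_1[OF assms] by simp
qed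

text \<open>Events that agree with a finite-dimensional cylinder up to a null set form an intersection-stable
  generator of the completed filtration.\<close>

definition almost_cylinders :: "'a measure \<Rightarrow> (real \<Rightarrow> 'a \<Rightarrow> real) \<Rightarrow> real \<Rightarrow> 'a set set" where
  "almost_cylinders M B T = {E. E \<subseteq> space M \<and> (\<exists>J S N. finite J \<and> J \<subseteq> {0..T} \<and> S \<in> sets (PiM J (\<lambda>_. borel)) \<and>
     N \<in> null_sets M \<and> (E - cylinder M B J S) \<union> (cylinder M B J S - E) \<subseteq> N)}"

lemma almost_cylinders_Int_stable: "Int_stable (almost_cylinders M B T)"
proof (rule Int_stableI)
  fix E1 E2 assume "E1 \<in> almost_cylinders M B T" "E2 \<in> almost_cylinders M B T"
  then obtain J1 S1 N1 J2 S2 N2 where E: "E1 \<subseteq> space M" "E2 \<subseteq> space M"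
    and J: "finite J1" "J1 \<subseteq> {0..T}" "finite J2" "J2 \<subseteq> {0..T}"
    and S: "S1 \<in> sets (PiM J1 (\<lambda>_. borel))" "S2 \<in> sets (PiM J2 (\<lambda>_. borel))"
    and N: "N1 \<in> null_sets M" "N2 \<in> null_sets M"
    "(E1 - cylinder M B J1 S1) \<union> (cylinder M B J1 S1 - E1) \<subseteq> N1"
    "(E2 - cylinder M B J2 S2) \<union> (cylinder M B J2 S2 - E2) \<subseteq> N2"
    unfolding almost_cylinders_def by blast
  let ?P = "PiM (J1 \<union> J2) (\<lambda>_. borel :: real measure)"
  define S where "S = ((\<lambda>f. restrict f J1) -` S1 \<inter> space ?P) \<inter> ((\<lambda>f. restrict f J2) -` S2 \<inter> space ?P)"
  have "S \<in> sets ?P"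
    unfolding S_def by (intro sets.Int measurable_sets[OF measurable_restrict_subset] S) auto
  moreover have "cylinder M B (J1 \<union> J2) S = cylinder M B J1 S1 \<inter> cylinder M B J2 S2"
  proof -
    have "restrict (\<lambda>s. B s \<omega>) (J1 \<union> J2) \<in> S \<longleftrightarrow> restrict (\<lambda>s. B s \<omega>) J1 \<in> S1 \<and> restrict (\<lambda>s. B s \<omega>) J2 \<in> S2" for \<omega>
    proof -
      have "(J1 \<union> J2) \<inter> J1 = J1" "(J1 \<union> J2) \<inter> J2 = J2" by auto
      then show ?thesis by (simp add: S_def space_PiM)
    qed
    then show ?thesis unfolding cylinder_def by blast
  qed
  moreover have "N1 \<union> N2 \<in> null_sets M" using N by auto
  ultimately show "E1 \<inter> E2 \<in> almost_cylinders M B T"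
    unfolding almost_cylinders_def using E(1) J N(3,4)
    by (intro CollectI conjI exI[of _ "J1 \<union> J2"] exI[of _ S] exI[of _ "N1 \<union> N2"]) (blast | simp)+
qed

text \<open>\<open>Xproc\<close> at time s is an affine function of B at s, so its events are
  cylinders over that single time; a subset of a null set differs from the empty cylinder only
  inside that null set.\<close>

lemma sets_filt_Xproc_subset:
  shows "sets (filt M (Xproc mu sig B x) T) \<subseteq> sigma_sets (space M) (almost_cylinders M B T)"
proof -
  have "Xproc mu sig B x s -` A \<inter> space M \<in> almost_cylinders M B T"
    if s: "0 \<le> s" "s \<le> T" and A: "A \<in> sets borel" for s A
  proof -
    define S where "S = (\<lambda>f. x + mu * s + sig * f s) -` A \<inter> space (PiM {s} (\<lambda>_. borel :: real measure))"
    have "S \<in> sets (PiM {s} (\<lambda>_. borel))"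
      unfolding S_def by (intro measurable_sets[OF _ A] borel_measurable_add borel_measurable_times
        borel_measurable_const measurable_component_singleton) simp
    moreover have "cylinder M B {s} S = Xproc mu sig B x s -` A \<inter> space M"
      by (auto simp: cylinder_def S_def Xproc_def space_PiM)
    ultimately show ?thesis
      unfolding almost_cylinders_def using s
      by (intro CollectI conjI exI[of _ "{s}"] exI[of _ S] exI[of _ "{}"]) auto
  qed
  moreover have "N \<in> almost_cylinders M B T" if "N \<subseteq> space M" "A \<in> null_sets M" "N \<subseteq> A" for N A
    unfolding almost_cylinders_def using that
    by (intro CollectI conjI exI[of _ "{}"] exI[of _ "{} :: (real \<Rightarrow> real) set"] exI[of _ A]) (auto simp: cylinder_def)
  ultimately have "{Xproc mu sig B x s -` A \<inter> space M | s A. 0 \<le> s \<and> s \<le> T \<and> A \<in> sets borel} \<union>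
      {N. N \<subseteq> space M \<and> (\<exists>A\<in>null_sets M. N \<subseteq> A)} \<subseteq> almost_cylinders M B T"
    by (intro Un_least subsetI) (elim CollectE exE bexE conjE, simp)+
  then show ?thesis
    unfolding filt_def by (subst sets_measure_of) (blast, rule sigma_sets_mono')
qed

text \<open>The filtration contains every subset of a null set, which need not be an event of
  \<open>M\<close>; probabilities are therefore taken in \<open>completion M\<close>.
  Almost-everywhere equality transfers independence from cylinders to the generator, and
  intersection stability transfers it to the generated sigma-algebra.\<close>

lemma filt_increment_indep:
  assumes BM: "std_BM M B" and T: "0 \<le> T" and t: "0 < t"
    and E': "E' \<in> sets (filt M (Xproc mu sig B x) T)" and A': "A' \<in> sets borel"
  shows "E' \<in> sets (completion M)"
    and "measure (completion M) (E' \<inter> ((\<lambda>\<omega>. B (T + t) \<omega> - B T \<omega>) -` A' \<inter> space M)) =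
      measure (completion M) E' * measure (completion M) ((\<lambda>\<omega>. B (T + t) \<omega> - B T \<omega>) -` A' \<inter> space M)"
proof -
  interpret M: prob_space M using BM by (simp add: std_BM_def)
  interpret C: prob_space "completion M" by (rule prob_space_completion) (rule M.prob_space_axioms)
  let ?D = "\<lambda>\<omega>. B (T + t) \<omega> - B T \<omega>"
  have B_meas: "B s \<in> borel_measurable M" for s using BM by (simp add: std_BM_def)
  have D_meas: "?D \<in> borel_measurable M" using B_meas by simp
  have D_ev: "?D -` A \<inter> space M \<in> sets M" if "A \<in> sets borel" for A
    using measurable_sets[OF D_meas that] .
  have cyl: "cylinder M B J S \<in> sets M" if "S \<in> sets (PiM J (\<lambda>_. borel))" for J S
    unfolding cylinder_def using B_meas by (intro measurable_sets[OF measurable_restrict that])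
  have E_sets: "E \<in> sets (completion M)" and E_AE: "\<exists>J S. finite J \<and> J \<subseteq> {0..T} \<and> S \<in> sets (PiM J (\<lambda>_. borel)) \<and>
      (AE \<omega> in completion M. \<omega> \<in> E \<longleftrightarrow> \<omega> \<in> cylinder M B J S)"
    if E: "E \<in> almost_cylinders M B T" for E
  proof -
    obtain J S N where J: "finite J" "J \<subseteq> {0..T}" and S: "S \<in> sets (PiM J (\<lambda>_. borel))"
      and N: "N \<in> null_sets M" "(E - cylinder M B J S) \<union> (cylinder M B J S - E) \<subseteq> N"
      and sp: "E \<subseteq> space M"
      using E unfolding almost_cylinders_def by blast
    show "E \<in> sets (completion M)"
      by (rule sets_completionI[of _ "cylinder M B J S - N" "E \<inter> N" N])
        (use N cyl[OF S] in auto)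
    have "AE \<omega> in completion M. \<omega> \<notin> N"
      by (rule AE_completion, rule AE_not_in) (rule N)
    then have "AE \<omega> in completion M. \<omega> \<in> E \<longleftrightarrow> \<omega> \<in> cylinder M B J S"
      by eventually_elim (use N in blast)
    then show "\<exists>J S. finite J \<and> J \<subseteq> {0..T} \<and> S \<in> sets (PiM J (\<lambda>_. borel)) \<and>
      (AE \<omega> in completion M. \<omega> \<in> E \<longleftrightarrow> \<omega> \<in> cylinder M B J S)" using J S by blast
  qed
  let ?DS = "{?D -` A \<inter> space M | A. A \<in> sets borel}"
  have "C.indep_set (almost_cylinders M B T) ?DS"
  proof (rule C.indep_setI)
    show "almost_cylinders M B T \<subseteq> C.events" using E_sets by blast
    show "?DS \<subseteq> C.events" using D_ev by auto
    fix E F assume E: "E \<in> almost_cylinders M B T" and "F \<in> ?DS"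
    then obtain A where A: "A \<in> sets borel" and F: "F = ?D -` A \<inter> space M" by blast
    have F_ev: "F \<in> sets M" using D_ev[OF A] F by simp
    obtain J S where J: "finite J" "J \<subseteq> {0..T}" and S: "S \<in> sets (PiM J (\<lambda>_. borel))"
      and ae: "AE \<omega> in completion M. \<omega> \<in> E \<longleftrightarrow> \<omega> \<in> cylinder M B J S"
      using E_AE[OF E] by blast
    have "C.prob (E \<inter> F) = C.prob (cylinder M B J S \<inter> F)"
      by (rule C.finite_measure_eq_AE) (use ae E_sets[OF E] cyl[OF S] F_ev in auto)
    also have "\<dots> = M.prob (cylinder M B J S) * M.prob F"
      using cylinder_increment_indep[OF BM J T t S A] cyl[OF S] F_ev unfolding F[symmetric] by simp
    also have "M.prob (cylinder M B J S) = C.prob (cylinder M B J S)" using cyl[OF S] by simp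
    also have "\<dots> = C.prob E"
      by (rule C.finite_measure_eq_AE) (use ae E_sets[OF E] cyl[OF S] in auto)
    finally show "C.prob (E \<inter> F) = C.prob E * C.prob F" using F_ev by simp
  qed
  moreover have "Int_stable ?DS"
  proof (rule Int_stableI)
    fix F1 F2 assume "F1 \<in> ?DS" "F2 \<in> ?DS"
    then obtain A1 A2 where "A1 \<in> sets borel" "A2 \<in> sets borel" "F1 = ?D -` A1 \<inter> space M" "F2 = ?D -` A2 \<inter> space M"
      by blast
    then show "F1 \<inter> F2 \<in> ?DS" by (intro CollectI exI[of _ "A1 \<inter> A2"]) auto
  qed
  ultimately have ind: "C.indep_set (sigma_sets (space M) (almost_cylinders M B T)) (sigma_sets (space M) ?DS)"
    using C.indep_set_sigma_sets[OF _ almost_cylinders_Int_stable] by simp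
  have E: "E' \<in> sigma_sets (space M) (almost_cylinders M B T)"
    using sets_filt_Xproc_subset E' by blast
  then show "E' \<in> sets (completion M)"
    using E_sets sets.sigma_sets_subset[of "almost_cylinders M B T" "completion M"] by auto
  have "?D -` A' \<inter> space M \<in> sigma_sets (space M) ?DS"
    using A' by (intro sigma_sets.Basic) blast
  then show "C.prob (E' \<inter> (?D -` A' \<inter> space M)) = C.prob E' * C.prob (?D -` A' \<inter> space M)"
    by (rule C.indep_setD[OF ind E])
qed

lemma space_filt: "space (filt M X T) = space M"
  unfolding filt_def by (rule space_measure_of) auto

lemma measurable_filt_completion:
  assumes BM: "std_BM M B" and T: "0 \<le> T" and Y: "Y \<in> filt M (Xproc mu sig B x) T \<rightarrow>\<^sub>M N"
  shows "Y \<in> completion M \<rightarrow>\<^sub>M N"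
proof (rule measurableI)
  show "Y \<omega> \<in> space N" if "\<omega> \<in> space (completion M)" for \<omega>
    using measurable_space[OF Y] that by (simp add: space_filt)
  show "Y -` A \<inter> space (completion M) \<in> sets (completion M)" if "A \<in> sets N" for A
    using filt_increment_indep(1)[OF BM T zero_less_one measurable_sets[OF Y that] sets.empty_sets]
    by (simp add: space_filt)
qed

text \<open>The Markov step without conditional expectations: the joint law of \<open>Y\<close> and
  the increment is a product, Tonelli separates the two, and the increment has a Gaussian density.
  \<open>Y\<close> may be a tuple collecting everything known at time T.\<close>

lemma nn_integral_filt_increment:
  assumes BM: "std_BM M B" and T: "0 \<le> T" and t: "0 < t"
    and Y: "Y \<in> filt M (Xproc mu sig B x) T \<rightarrow>\<^sub>M N"
    and f: "f \<in> borel_measurable (N \<Otimes>\<^sub>M borel)"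
  shows "(\<integral>\<^sup>+ \<omega>. f (Y \<omega>, B (T + t) \<omega> - B T \<omega>) \<partial>completion M) =
    (\<integral>\<^sup>+ \<omega>. (\<integral>\<^sup>+ b. ennreal (normal_density 0 (sqrt t) b) * f (Y \<omega>, b) \<partial>lborel) \<partial>completion M)"
proof -
  interpret M: prob_space M using BM by (simp add: std_BM_def)
  interpret C: prob_space "completion M" by (rule prob_space_completion) (rule M.prob_space_axioms)
  let ?D = "\<lambda>\<omega>. B (T + t) \<omega> - B T \<omega>"
  have Y': "Y \<in> completion M \<rightarrow>\<^sub>M N" by (rule measurable_filt_completion[OF BM T Y])
  have "B s \<in> borel_measurable M" for s using BM by (simp add: std_BM_def)
  then have D: "?D \<in> borel_measurable M" by simp
  then have D': "?D \<in> completion M \<rightarrow>\<^sub>M borel" by (rule measurable_completion)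
  interpret D: prob_space "distr (completion M) borel ?D" by (rule C.prob_space_distr[OF D'])
  interpret Y: prob_space "distr (completion M) N Y" by (rule C.prob_space_distr[OF Y'])
  have eq: "distr (completion M) N Y \<Otimes>\<^sub>M distr (completion M) borel ?D = distr (completion M) (N \<Otimes>\<^sub>M borel) (\<lambda>\<omega>. (Y \<omega>, ?D \<omega>))"
  proof (rule pair_measure_eqI)
    fix E A assume "E \<in> sets (distr (completion M) N Y)" and "A \<in> sets (distr (completion M) borel ?D)"
    then have E: "E \<in> sets N" and A: "A \<in> sets borel" by simp_all
    have YE: "Y -` E \<inter> space M \<in> sets (filt M (Xproc mu sig B x) T)"
      using measurable_sets[OF Y E] by (simp add: space_filt)
    have "emeasure (distr (completion M) N Y) E * emeasure (distr (completion M) borel ?D) A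
      = ennreal (C.prob (Y -` E \<inter> space M)) * ennreal (C.prob (?D -` A \<inter> space M))"
      using Y' D' E A by (simp add: emeasure_distr C.emeasure_eq_measure)
    also have "\<dots> = ennreal (C.prob ((Y -` E \<inter> space M) \<inter> (?D -` A \<inter> space M)))"
      unfolding filt_increment_indep(2)[OF BM T t YE A] by (simp add: ennreal_mult)
    also have "(Y -` E \<inter> space M) \<inter> (?D -` A \<inter> space M) = (\<lambda>\<omega>. (Y \<omega>, ?D \<omega>)) -` (E \<times> A) \<inter> space (completion M)"
      by auto
    also have "ennreal (C.prob \<dots>) = emeasure (distr (completion M) (N \<Otimes>\<^sub>M borel) (\<lambda>\<omega>. (Y \<omega>, ?D \<omega>))) (E \<times> A)"
      using Y' D' E A by (subst emeasure_distr) (auto simp: C.emeasure_eq_measure)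
    finally show "emeasure (distr (completion M) N Y) E * emeasure (distr (completion M) borel ?D) A =
      emeasure (distr (completion M) (N \<Otimes>\<^sub>M borel) (\<lambda>\<omega>. (Y \<omega>, ?D \<omega>))) (E \<times> A)" .
  next
    show "sets (distr (completion M) N Y \<Otimes>\<^sub>M distr (completion M) borel ?D) =
      sets (distr (completion M) (N \<Otimes>\<^sub>M borel) (\<lambda>\<omega>. (Y \<omega>, ?D \<omega>)))"
      unfolding sets_distr by (rule sets_pair_measure_cong) simp_all
  qed (rule Y.sigma_finite_measure_axioms D.sigma_finite_measure_axioms)+
  have "T < T + t" using t by simp
  then have dist: "distributed M lborel ?D (normal_density 0 (sqrt t))"
    using BM[unfolded std_BM_def, THEN conjunct2, THEN conjunct2, THEN conjunct2, THEN conjunct1, rule_format, of T "T + t"] T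
    by simp
  have "distr (completion M) borel ?D = distr M borel ?D"
    by (rule distr_completion) (rule D)
  also have "\<dots> = distr M lborel ?D" by (intro distr_cong) auto
  also have "\<dots> = density lborel (normal_density 0 (sqrt t))" by (rule distributed_distr_eq_density[OF dist])
  finally have D_eq: "distr (completion M) borel ?D = density lborel (normal_density 0 (sqrt t))" .
  have "(\<integral>\<^sup>+ \<omega>. f (Y \<omega>, ?D \<omega>) \<partial>completion M) = (\<integral>\<^sup>+ z. f z \<partial>distr (completion M) (N \<Otimes>\<^sub>M borel) (\<lambda>\<omega>. (Y \<omega>, ?D \<omega>)))"
    using Y' D' f by (subst nn_integral_distr) auto
  also have "\<dots> = (\<integral>\<^sup>+ y. \<integral>\<^sup>+ b. f (y, b) \<partial>distr (completion M) borel ?D \<partial>distr (completion M) N Y)"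
    unfolding eq[symmetric] using f by (subst D.nn_integral_fst) auto
  also have "\<dots> = (\<integral>\<^sup>+ \<omega>. \<integral>\<^sup>+ b. f (Y \<omega>, b) \<partial>distr (completion M) borel ?D \<partial>completion M)"
    using Y' f D.borel_measurable_nn_integral_fst[of f N] by (subst nn_integral_distr) auto
  also have "\<dots> = (\<integral>\<^sup>+ \<omega>. (\<integral>\<^sup>+ b. ennreal (normal_density 0 (sqrt t) b) * f (Y \<omega>, b) \<partial>lborel) \<partial>completion M)"
  proof (rule nn_integral_cong)
    fix \<omega> assume "\<omega> \<in> space (completion M)"
    then have "Y \<omega> \<in> space N" using measurable_space[OF Y'] by simp
    then have "(\<lambda>b. f (Y \<omega>, b)) \<in> borel_measurable borel" using f by measurable
    then show "(\<integral>\<^sup>+ b. f (Y \<omega>, b) \<partial>distr (completion M) borel ?D) = (\<integral>\<^sup>+ b. ennreal (normal_density 0 (sqrt t) b) * f (Y \<omega>, b) \<partial>lborel)"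
      unfolding D_eq by (subst nn_integral_density) auto
  qed
  finally show ?thesis .
qed

section \<open>Strategies frozen on a time grid\<close>

lemma nn_integral_exp_Icc:
  assumes "0 < q" "a \<le> b"
  shows "(\<integral>\<^sup>+ s. ennreal (exp (- q * s)) * indicator {a..b} s \<partial>lborel) = ennreal ((exp (- q * a) - exp (- q * b)) / q)"
proof -
  have "(\<integral>\<^sup>+ s. ennreal (exp (- q * s)) * indicator {a..b} s \<partial>lborel) = ennreal (- exp (- q * b) / q - - exp (- q * a) / q)"
    using assms by (intro nn_integral_FTC_Icc) (auto intro!: derivative_eq_intros)
  then show ?thesis by (simp add: diff_divide_distrib)
qed

text \<open>A lower Riemann sum: on each step a nondecreasing C stays above its left value. It puts
  the grid surplus above the true one.\<close>

lemma mono_integral_ge_left_sum: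
  fixes C :: "real \<Rightarrow> real"
  assumes mono: "mono_on {0..} C" and t: "0 < t"
    and D: "\<And>k. D k \<le> C (real k * t)"
  shows "t * (\<Sum>j<k. D j) \<le> integral {0..real k * t} C"
proof (induction k)
  case (Suc k)
  have int: "C integrable_on {a..b}" if "0 \<le> a" for a b
    using that by (intro integrable_on_mono_on mono_on_subset[OF mono]) auto
  have "integral {0..real k * t} C + integral {real k * t..real (Suc k) * t} C = integral {0..real (Suc k) * t} C"
    using t by (intro Henstock_Kurzweil_Integration.integral_combine int) (auto simp: mult_right_mono)
  moreover have "integral {real k * t..real (Suc k) * t} (\<lambda>_. D k) \<le> integral {real k * t..real (Suc k) * t} C"
  proof (rule integral_le)
    show "D k \<le> C s" if "s \<in> {real k * t..real (Suc k) * t}" for s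
    proof -
      have "0 \<le> real k * t" using t by simp
      then have "C (real k * t) \<le> C s" using that by (intro mono_onD[OF mono]) auto
      then show ?thesis using D[of k] by simp
    qed
  qed (use t in \<open>auto intro!: int integrable_const_ivl\<close>)
  moreover have "integral {real k * t..real (Suc k) * t} (\<lambda>_. D k) = t * D k"
    using t by (simp add: algebra_simps)
  moreover have "t * (\<Sum>j<Suc k. D j) = t * (\<Sum>j<k. D j) + t * D k" by (simp add: distrib_left)
  ultimately show ?case using Suc.IH by linarith
qed simp

text \<open>Each step has weight at most t, so the increments of c telescope to at most t * chi; the
  constant \<open>de\<close> is multiplied by the total discounted time, at most 1 / q.\<close>

lemma discounted_increments_sum_le:
  fixes c :: "nat \<Rightarrow> real"
  assumes q: "0 < q" and t: "0 < t" and de: "0 \<le> de"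
    and c: "\<And>k. c k \<le> c (Suc k)" "\<And>k. 0 \<le> c k" "\<And>k. c k \<le> chi"
  shows "(\<Sum>k. ennreal (exp (- q * t) ^ k * ((1 - exp (- q * t)) / q)) * ennreal (de + (c (Suc k) - c k)))
    \<le> ennreal (de / q + t * chi)"
proof -
  define b where "b = exp (- q * t)"
  have b: "0 < b" "b < 1" using q t by (auto simp: b_def)
  define a where "a = (1 - b) / q"
  have a: "0 \<le> a" "a \<le> t"
  proof -
    show "0 \<le> a" using b q by (simp add: a_def)
    have "1 - b \<le> q * t" using exp_ge_add_one_self[of "- q * t"] by (simp add: b_def)
    then show "a \<le> t" using q by (simp add: a_def divide_simps mult.commute)
  qed
  have "(\<Sum>k<n. ennreal (b ^ k * a) * ennreal (de + (c (Suc k) - c k))) \<le> ennreal (de / q + t * chi)" for n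
  proof -
    have "(\<Sum>k<n. ennreal (b ^ k * a) * ennreal (de + (c (Suc k) - c k))) =
        (\<Sum>k<n. ennreal (b ^ k * a * (de + (c (Suc k) - c k))))"
      using a b de c by (intro sum.cong refl ennreal_mult[symmetric]) (auto intro!: add_nonneg_nonneg)
    also have "\<dots> = ennreal (\<Sum>k<n. b ^ k * a * (de + (c (Suc k) - c k)))"
      using a b de c by (intro sum_ennreal) (auto intro!: mult_nonneg_nonneg add_nonneg_nonneg)
    also have "\<dots> \<le> ennreal (de / q + t * chi)"
    proof (rule ennreal_leI)
      have "(\<Sum>k<n. b ^ k * a * (de + (c (Suc k) - c k))) \<le> (\<Sum>k<n. de * a * b ^ k + t * (c (Suc k) - c k))"
      proof (rule sum_mono)
        fix k
        have "b ^ k * a \<le> 1 * t" using a b by (intro mult_mono) (auto simp: power_le_one)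
        then have "b ^ k * a * (c (Suc k) - c k) \<le> t * (c (Suc k) - c k)"
          using c(1)[of k] by (intro mult_right_mono) auto
        then show "b ^ k * a * (de + (c (Suc k) - c k)) \<le> de * a * b ^ k + t * (c (Suc k) - c k)"
          by (simp add: algebra_simps)
      qed
      also have "\<dots> = de * (a * (\<Sum>k<n. b ^ k)) + t * (c n - c 0)"
        by (simp add: sum.distrib sum_distrib_left[symmetric] sum_lessThan_telescope mult.assoc)
      also have "a * (\<Sum>k<n. b ^ k) = (1 - b ^ n) / q"
        using b q by (simp add: a_def sum_gp_strict)
      also have "de * ((1 - b ^ n) / q) + t * (c n - c 0) \<le> de * (1 / q) + t * chi"
        using b q de t c(2)[of 0] c(3)[of n] by (intro add_mono mult_left_mono divide_right_mono) auto
      finally show "(\<Sum>k<n. b ^ k * a * (de + (c (Suc k) - c k))) \<le> de / q + t * chi" by simp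
    qed
    finally show ?thesis .
  qed
  then show ?thesis
    unfolding b_def[symmetric] a_def[symmetric] suminf_eq_SUP by (intro SUP_least)
qed

text \<open>Ruin is only looked for on the grid, for a strategy that pays less; both changes delay ruin.
  The rewards lost by freezing the strategy between grid points telescope.\<close>

lemma grid_path_bound:
  fixes C y :: "real \<Rightarrow> real" and D X :: "nat \<Rightarrow> real"
  assumes q: "0 < q" and t: "0 < t" and de: "0 \<le> de"
    and mono: "mono_on {0..} C" and C: "\<And>s. 0 \<le> s \<Longrightarrow> 0 \<le> C s" "\<And>s. 0 \<le> s \<Longrightarrow> C s \<le> chi"
    and D: "\<And>k. D k \<le> C (real k * t)" "\<And>k. C (real k * t) \<le> D k + de" "\<And>k. 0 \<le> D k"
    and X: "\<And>k. X k = y (real k * t) - t * (\<Sum>j<k. D j)"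
  shows "(\<integral>\<^sup>+ s. indicator {s. 0 \<le> s \<and> ereal s < Inf {ereal s | s. 0 \<le> s \<and> y s - integral {0..s} C < 0}} s
        * ennreal (exp (- q * s) * C s) \<partial>lborel)
     \<le> (\<Sum>k. ennreal (exp (- q * t) ^ k) * ((\<Prod>j\<le>k. indicator {0..} (X j)) * ennreal ((1 - exp (- q * t)) / q * D k)))
       + ennreal (de / q + t * chi)"
proof -
  let ?tau = "Inf {ereal s | s. 0 \<le> s \<and> y s - integral {0..s} C < 0}"
  define I where "I = (\<lambda>k::nat. {real k * t..real (Suc k) * t})"
  define Z where "Z = (\<lambda>k. \<Prod>j\<le>k. indicator {0..} (X j) :: ennreal)"
  \<comment> \<open>On step k the strategy exceeds \<open>D k\<close> by at most the rounding error
    plus its own growth over the step.\<close>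
  define e where "e = (\<lambda>k::nat. de + (C (real (Suc k) * t) - C (real k * t)))"
  have C_Suc: "C (real k * t) \<le> C (real (Suc k) * t)" for k
    using t by (intro mono_onD[OF mono]) (auto simp: mult_right_mono)
  have e: "0 \<le> e k" for k using de C_Suc[of k] by (simp add: e_def)
  \<comment> \<open>The closed step intervals overlap in end points, which is harmless for an upper
    bound. The excess \<open>e k\<close> carries no survival factor, so its sum can be bounded path
    by path.\<close>
  define G where "G = (\<lambda>k s. ennreal (exp (- q * s)) * indicator (I k) s * (Z k * ennreal (D k) + ennreal (e k)))"
  have "indicator {s. 0 \<le> s \<and> ereal s < ?tau} s * ennreal (exp (- q * s) * C s) \<le> (\<Sum>k. G k s)" for s
  proof (cases "0 \<le> s \<and> ereal s < ?tau")
    case True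
    then have s: "0 \<le> s" "ereal s < ?tau" by auto
    define k where "k = nat \<lfloor>s / t\<rfloor>"
    have k: "real k * t \<le> s" "s \<le> real (Suc k) * t"
    proof -
      have k_eq: "real k = of_int \<lfloor>s / t\<rfloor>" using s t by (simp add: k_def)
      have "real k \<le> s / t" "s / t \<le> real k + 1" unfolding k_eq by linarith+
      then show "real k * t \<le> s" "s \<le> real (Suc k) * t"
        using t by (auto simp: divide_simps algebra_simps)
    qed
    \<comment> \<open>The true surplus at time j * t is at most \<open>X j\<close>; were this
      negative, ruin would have occurred by time j * t \<le> s.\<close>
    have "0 \<le> X j" if "j \<le> k" for j
    proof (rule ccontr)
      assume neg: "\<not> 0 \<le> X j"
      have jt: "0 \<le> real j * t" "real j * t \<le> s"
        using t that order_trans[OF mult_right_mono[of "real j" "real k" t] k(1)] by auto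
      have "y (real j * t) - integral {0..real j * t} C \<le> X j"
        using mono_integral_ge_left_sum[OF mono t D(1), of j] by (simp add: X)
      then have "?tau \<le> ereal (real j * t)"
        using neg jt by (intro Inf_lower) (auto intro!: exI[of _ "real j * t"])
      also have "\<dots> \<le> ereal s" using jt by simp
      finally show False using s by simp
    qed
    then have Z1: "Z k = 1" by (simp add: Z_def)
    have "C s \<le> C (real (Suc k) * t)"
      using s k by (intro mono_onD[OF mono]) auto
    then have "C s \<le> D k + e k" using D(2)[of k] by (simp add: e_def)
    then have "ennreal (exp (- q * s) * C s) \<le> ennreal (exp (- q * s) * (D k + e k))"
      by (intro ennreal_leI mult_left_mono) auto
    also have "\<dots> = G k s"
      using D(3)[of k] e[of k] k Z1 by (simp add: G_def I_def ennreal_mult' ennreal_plus)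
    also have "\<dots> \<le> (\<Sum>k. G k s)"
      using sum_le_suminf[of "\<lambda>k. G k s" "{k}"] by simp
    finally show ?thesis using True by simp
  qed simp
  then have "(\<integral>\<^sup>+ s. indicator {s. 0 \<le> s \<and> ereal s < ?tau} s * ennreal (exp (- q * s) * C s) \<partial>lborel)
     \<le> (\<integral>\<^sup>+ s. (\<Sum>k. G k s) \<partial>lborel)"
    by (rule nn_integral_mono)
  also have "\<dots> = (\<Sum>k. \<integral>\<^sup>+ s. G k s \<partial>lborel)"
    unfolding G_def I_def by (intro nn_integral_suminf) measurable
  also have "\<dots> = (\<Sum>k. ennreal (exp (- q * t) ^ k * ((1 - exp (- q * t)) / q)) * (Z k * ennreal (D k) + ennreal (e k)))"
  proof (intro suminf_cong)
    fix k
    have "exp (- q * (real (Suc k) * t)) = exp (- q * t) * exp (- q * t) ^ k"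
      "exp (- q * (real k * t)) = exp (- q * t) ^ k"
      by (simp_all add: exp_of_nat_mult[symmetric] exp_add[symmetric] algebra_simps)
    then have "(exp (- q * (real k * t)) - exp (- q * (real (Suc k) * t))) / q = exp (- q * t) ^ k * ((1 - exp (- q * t)) / q)"
      by (simp add: algebra_simps)
    moreover have "(\<integral>\<^sup>+ s. ennreal (exp (- q * s)) * indicator (I k) s \<partial>lborel) =
       ennreal ((exp (- q * (real k * t)) - exp (- q * (real (Suc k) * t))) / q)"
      unfolding I_def using t by (intro nn_integral_exp_Icc[OF q]) (simp add: mult_right_mono)
    ultimately show "(\<integral>\<^sup>+ s. G k s \<partial>lborel) = ennreal (exp (- q * t) ^ k * ((1 - exp (- q * t)) / q)) * (Z k * ennreal (D k) + ennreal (e k))"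
      unfolding G_def by (subst nn_integral_multc) (auto simp: I_def)
  qed
  also have "\<dots> = (\<Sum>k. ennreal (exp (- q * t) ^ k * ((1 - exp (- q * t)) / q)) * (Z k * ennreal (D k)))
      + (\<Sum>k. ennreal (exp (- q * t) ^ k * ((1 - exp (- q * t)) / q)) * ennreal (e k))"
    unfolding distrib_left by (rule suminf_add[symmetric]) auto
  also have "(\<Sum>k. ennreal (exp (- q * t) ^ k * ((1 - exp (- q * t)) / q)) * ennreal (e k)) \<le> ennreal (de / q + t * chi)"
    unfolding e_def
    by (rule discounted_increments_sum_le[OF q t de, of "\<lambda>k. C (real k * t)"]) (use C_Suc C t in auto)
  also have "(\<Sum>k. ennreal (exp (- q * t) ^ k * ((1 - exp (- q * t)) / q)) * (Z k * ennreal (D k))) =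
     (\<Sum>k. ennreal (exp (- q * t) ^ k) * (Z k * ennreal ((1 - exp (- q * t)) / q * D k)))"
  proof (intro suminf_cong)
    fix k
    have "0 \<le> (1 - exp (- q * t)) / q" using q t by simp
    then have "ennreal (exp (- q * t) ^ k * ((1 - exp (- q * t)) / q)) = ennreal (exp (- q * t) ^ k) * ennreal ((1 - exp (- q * t)) / q)"
      "ennreal ((1 - exp (- q * t)) / q * D k) = ennreal ((1 - exp (- q * t)) / q) * ennreal (D k)"
      using D(3)[of k] by (auto intro!: ennreal_mult simp del: times_divide_eq_left times_divide_eq_right)
    then show "ennreal (exp (- q * t) ^ k * ((1 - exp (- q * t)) / q)) * (Z k * ennreal (D k)) =
        ennreal (exp (- q * t) ^ k) * (Z k * ennreal ((1 - exp (- q * t)) / q * D k))"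
      by (simp only: mult_ac)
  qed
  finally show ?thesis unfolding Z_def by simp
qed

lemma Jval_integral_le:
  assumes M: "prob_space M" and q: "0 < q"
    and C: "\<And>\<omega> s. \<omega> \<in> space M \<Longrightarrow> 0 \<le> s \<Longrightarrow> C s \<omega> \<le> chi" and chi: "0 \<le> chi"
  shows "(\<integral>\<^sup>+ \<omega>. (\<integral>\<^sup>+ s. indicator {s. 0 \<le> s \<and> ereal s < ruin_time mu sig B x C \<omega>} s
              * ennreal (exp (- q * s) * C s \<omega>) \<partial>lborel) \<partial>M) \<le> ennreal (chi / q)"
proof -
  interpret prob_space M by (rule M)
  have "(\<integral>\<^sup>+ s. indicator {s. 0 \<le> s \<and> ereal s < ruin_time mu sig B x C \<omega>} s
              * ennreal (exp (- q * s) * C s \<omega>) \<partial>lborel) \<le> ennreal (chi / q)" if "\<omega> \<in> space M" for \<omega>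
  proof -
    have "(\<integral>\<^sup>+ s. indicator {s. 0 \<le> s \<and> ereal s < ruin_time mu sig B x C \<omega>} s
              * ennreal (exp (- q * s) * C s \<omega>) \<partial>lborel) \<le> (\<integral>\<^sup>+ s. ennreal (chi * exp (- q * s)) * indicator {0..} s \<partial>lborel)"
      using C[OF that] by (intro nn_integral_mono) (auto simp: indicator_def mult.commute intro!: ennreal_leI)
    also have "\<dots> = ennreal (0 - - (chi / q) * exp (- q * 0))"
    proof (rule nn_integral_FTC_atLeast)
      show "((\<lambda>s. - (chi / q) * exp (- q * s)) \<longlongrightarrow> 0) at_top"
        using q by (intro tendsto_mult_right_zero filterlim_compose[OF exp_at_bot]
          filterlim_tendsto_neg_mult_at_bot[OF tendsto_const _ filterlim_ident]) simp
    qed (use q chi in \<open>auto intro!: derivative_eq_intros\<close>)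
    finally show ?thesis by simp
  qed
  then have "(\<integral>\<^sup>+ \<omega>. (\<integral>\<^sup>+ s. indicator {s. 0 \<le> s \<and> ereal s < ruin_time mu sig B x C \<omega>} s
              * ennreal (exp (- q * s) * C s \<omega>) \<partial>lborel) \<partial>M) \<le> (\<integral>\<^sup>+ \<omega>. ennreal (chi / q) \<partial>M)"
    by (rule nn_integral_mono)
  then show ?thesis by (simp add: emeasure_space_1)
qed

text \<open>Iterating the inequality with weights b^k telescopes the terms a; the nonnegative
  remainder is dropped and the errors form a geometric series.\<close>

lemma discounted_recursion_bound:
  fixes a r :: "nat \<Rightarrow> ennreal" and b err :: real
  assumes b: "0 \<le> b" "b < 1" and err: "0 \<le> err"
    and step: "\<And>k. r k + ennreal b * a (Suc k) \<le> a k + ennreal err"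
  shows "(\<Sum>k. ennreal (b ^ k) * r k) \<le> a 0 + ennreal (err / (1 - b))"
proof -
  have partial: "(\<Sum>k<n. ennreal (b ^ k) * r k) + ennreal (b ^ n) * a n \<le> a 0 + ennreal (err * (\<Sum>k<n. b ^ k))" for n
  proof (induction n)
    case (Suc n)
    have "(\<Sum>k<Suc n. ennreal (b ^ k) * r k) + ennreal (b ^ Suc n) * a (Suc n) =
        (\<Sum>k<n. ennreal (b ^ k) * r k) + ennreal (b ^ n) * (r n + ennreal b * a (Suc n))"
      using b by (simp add: ennreal_mult distrib_left mult_ac add_ac)
    also have "\<dots> \<le> (\<Sum>k<n. ennreal (b ^ k) * r k) + ennreal (b ^ n) * (a n + ennreal err)"
      by (intro add_left_mono mult_left_mono step) auto
    also have "\<dots> = ((\<Sum>k<n. ennreal (b ^ k) * r k) + ennreal (b ^ n) * a n) + ennreal (err * b ^ n)"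
      using b err by (simp add: ennreal_mult distrib_left mult_ac add_ac)
    also have "\<dots> \<le> (a 0 + ennreal (err * (\<Sum>k<n. b ^ k))) + ennreal (err * b ^ n)"
      by (intro add_right_mono Suc.IH)
    also have "\<dots> = a 0 + ennreal (err * (\<Sum>k<n. b ^ k) + err * b ^ n)"
      using b err by (subst ennreal_plus) (auto simp: add.assoc intro!: mult_nonneg_nonneg sum_nonneg)
    also have "err * (\<Sum>k<n. b ^ k) + err * b ^ n = err * (\<Sum>k<Suc n. b ^ k)"
      by (simp add: distrib_left)
    finally show ?case .
  qed simp
  have "(\<Sum>k<n. ennreal (b ^ k) * r k) \<le> a 0 + ennreal (err / (1 - b))" for n
  proof -
    have "(\<Sum>k<n. ennreal (b ^ k) * r k) \<le> (\<Sum>k<n. ennreal (b ^ k) * r k) + ennreal (b ^ n) * a n" by simp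
    also have "\<dots> \<le> a 0 + ennreal (err * (\<Sum>k<n. b ^ k))" by (rule partial)
    also have "\<dots> \<le> a 0 + ennreal (err / (1 - b))"
    proof (intro add_left_mono ennreal_leI)
      have "(\<Sum>k<n. b ^ k) \<le> 1 / (1 - b)" using b by (simp add: sum_gp_strict divide_right_mono)
      then show "err * (\<Sum>k<n. b ^ k) \<le> err / (1 - b)"
        using mult_left_mono[of _ "1 / (1 - b)" err] err by simp
    qed
    finally show ?thesis .
  qed
  then show ?thesis unfolding suminf_eq_SUP by (intro SUP_least)
qed

section \<open>The discounted value process along the grid\<close>

lemma filt_generator_subset: "{X s -` A \<inter> space M | s A. 0 \<le> s \<and> s \<le> T \<and> A \<in> sets borel} \<union>
      {N. N \<subseteq> space M \<and> (\<exists>A\<in>null_sets M. N \<subseteq> A)} \<subseteq> Pow (space M)"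
  by auto

lemma measurable_filt_mono:
  assumes "s \<le> T" "f \<in> filt M X s \<rightarrow>\<^sub>M N"
  shows "f \<in> filt M X T \<rightarrow>\<^sub>M N"
proof -
  have "sets (filt M X s) \<subseteq> sets (filt M X T)"
    unfolding filt_def sets_measure_of[OF filt_generator_subset]
  proof (intro sigma_sets_mono' Un_mono order_refl subsetI)
    fix E assume "E \<in> {X r -` A \<inter> space M | r A. 0 \<le> r \<and> r \<le> s \<and> A \<in> sets borel}"
    then obtain r A where "E = X r -` A \<inter> space M" "0 \<le> r" "r \<le> s" "A \<in> sets borel" by blast
    moreover from this have "r \<le> T" using assms(1) by simp
    ultimately show "E \<in> {X r -` A \<inter> space M | r A. 0 \<le> r \<and> r \<le> T \<and> A \<in> sets borel}" by blast
  qed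
  then show ?thesis using assms(2) unfolding measurable_def space_filt by blast
qed

lemma measurable_filt_process:
  assumes "0 \<le> s" "s \<le> T"
  shows "X s \<in> borel_measurable (filt M X T)"
proof (rule measurableI)
  fix A :: "real set" assume "A \<in> sets borel"
  then show "X s -` A \<inter> space (filt M X T) \<in> sets (filt M X T)"
    unfolding space_filt unfolding filt_def sets_measure_of[OF filt_generator_subset]
    using assms by (intro sigma_sets.Basic) blast
qed simp

text \<open>On paths alive on the grid, W (X k + eps, D k) plus rewards is a discounted
  supermartingale up to \<open>err\<close>. The next level may depend on the next increment, so W is
  first bounded by its value at the old level, using \<open>anti\<close>; the old level is known at
  the start of the step, the increment is independent of it, and \<open>step\<close>
  applies.\<close>

lemma grid_value_le:
  fixes D X :: "nat \<Rightarrow> 'a \<Rightarrow> real" and B :: "real \<Rightarrow> 'a \<Rightarrow> real"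
  assumes BM: "std_BM M B" and t: "0 < t" and q: "0 < q" and x: "0 \<le> x"
    and F: "finite F" "F \<subseteq> {clo..<chi}" and eps: "0 < eps" and err: "0 \<le> err"
    and anti: "\<And>y d d'. 0 < y \<Longrightarrow> clo \<le> d \<Longrightarrow> d \<le> d' \<Longrightarrow> d' < chi \<Longrightarrow> W (y, d') \<le> W (y, d)"
    and cont: "\<And>d. d \<in> F \<Longrightarrow> continuous_on {0..} (\<lambda>y. W (y, d))"
    and step: "\<And>y d. 0 \<le> y \<Longrightarrow> d \<in> F \<Longrightarrow>
      ennreal (d * (1 - exp (- q * t)) / q) + ennreal (exp (- q * t)) *
        (\<integral>\<^sup>+ b. ennreal (normal_density 0 (sqrt t) b) *
           ennreal (if 0 \<le> y + ((mu - d) * t + sig * b) then W (y + ((mu - d) * t + sig * b) + eps, d) else 0) \<partial>lborel)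
      \<le> ennreal (W (y + eps, d)) + ennreal err"
    and c: "clo \<le> c" "c < chi"
    and D_F: "\<And>k \<omega>. \<omega> \<in> space M \<Longrightarrow> D k \<omega> \<in> F"
    and D_mono: "\<And>k \<omega>. \<omega> \<in> space M \<Longrightarrow> D k \<omega> \<le> D (Suc k) \<omega>"
    and D_0: "\<And>\<omega>. \<omega> \<in> space M \<Longrightarrow> c \<le> D 0 \<omega>"
    and D_meas: "\<And>k. D k \<in> borel_measurable (filt M (Xproc mu sig B x) (real k * t))"
    and X: "\<And>k \<omega>. X k \<omega> = Xproc mu sig B x (real k * t) \<omega> - t * (\<Sum>j<k. D j \<omega>)"
  shows "(\<Sum>k. ennreal (exp (- q * t) ^ k) *
       (\<integral>\<^sup>+ \<omega>. (\<Prod>j\<le>k. indicator {0..} (X j \<omega>)) * ennreal ((1 - exp (- q * t)) / q * D k \<omega>) \<partial>completion M))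
     \<le> ennreal (W (x + eps, c)) + ennreal (err / (1 - exp (- q * t)))"
proof -
  interpret M: prob_space M using BM by (simp add: std_BM_def)
  interpret C: prob_space "completion M" by (rule prob_space_completion) (rule M.prob_space_axioms)
  define al where "al = (1 - exp (- q * t)) / q"
  define be where "be = exp (- q * t)"
  have be: "0 \<le> be" "be < 1" and al: "0 \<le> al" using q t by (auto simp: be_def al_def)
  define g where "g = (\<lambda>d y. ennreal (if y \<in> {0..} then W (y + eps, d) else 0))"
  have g_meas: "g d \<in> borel_measurable borel" if "d \<in> F" for d
  proof -
    have "continuous_on {0..} (\<lambda>y. W (y + eps, d))"
      using eps by (intro continuous_on_compose2[OF cont[OF that]] continuous_intros) auto
    then have "(\<lambda>y. if y \<in> {0..} then W (y + eps, d) else 0) \<in> borel_measurable borel"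
      by (intro borel_measurable_continuous_on_if) auto
    then show ?thesis unfolding g_def by simp
  qed
  have ind_meas: "(indicator {d} :: real \<Rightarrow> ennreal) \<in> borel_measurable borel" for d
    by (rule borel_measurable_indicator) simp
  \<comment> \<open>Here W is known to be continuous in the space variable at each level of
    \<open>F\<close> only; the finite sum with indicators selects the level measurably.\<close>
  define U where "U = (\<lambda>y d. \<Sum>d'\<in>F. indicator {d'} d * g d' y)"
  have U_eq: "U y d = g d y" if "d \<in> F" for y d
  proof -
    have "U y d = (\<Sum>d'\<in>F. if d' = d then g d y else 0)"
      unfolding U_def by (intro sum.cong) (auto simp: indicator_def)
    then show ?thesis using that F(1) by (simp add: sum.delta')
  qed
  define N where "N = (borel :: ennreal measure) \<Otimes>\<^sub>M (borel :: real measure) \<Otimes>\<^sub>M (borel :: real measure)"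
  \<comment> \<open>One step as a function of the past, the triple of survival factor, surplus and
    level, and of the increment b. The drift may use \<open>d'\<close>, which is the actual level
    wherever the indicator is nonzero.\<close>
  define f where "f = (\<lambda>(p :: ennreal \<times> real \<times> real, b :: real). fst p * (ennreal (al * snd (snd p)) +
     ennreal be * (\<Sum>d'\<in>F. indicator {d'} (snd (snd p)) * g d' (fst (snd p) + ((mu - d') * t + sig * b)))))"
  have f_meas: "f \<in> borel_measurable (N \<Otimes>\<^sub>M borel)"
  proof -
    have p: "(\<lambda>x. fst (fst x)) \<in> borel_measurable (N \<Otimes>\<^sub>M (borel :: real measure))"
      "(\<lambda>x. fst (snd (fst x))) \<in> borel_measurable (N \<Otimes>\<^sub>M (borel :: real measure))"
      "(\<lambda>x. snd (snd (fst x))) \<in> borel_measurable (N \<Otimes>\<^sub>M (borel :: real measure))"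
      "(\<lambda>x. snd x) \<in> borel_measurable (N \<Otimes>\<^sub>M (borel :: real measure))"
      unfolding N_def by (measurable)
    have "(\<lambda>x. fst (snd (fst x)) + ((mu - d') * t + sig * snd x)) \<in> borel_measurable (N \<Otimes>\<^sub>M borel)" for d'
      by (intro borel_measurable_add borel_measurable_times borel_measurable_const p(2,4))
    then have "(\<lambda>x. indicator {d'} (snd (snd (fst x))) * g d' (fst (snd (fst x)) + ((mu - d') * t + sig * snd x)))
        \<in> borel_measurable (N \<Otimes>\<^sub>M borel)" if "d' \<in> F" for d'
      by (rule borel_measurable_times_ennreal[OF measurable_compose[OF p(3) ind_meas] measurable_compose[OF _ g_meas[OF that]]])
    then have "(\<lambda>x. \<Sum>d'\<in>F. indicator {d'} (snd (snd (fst x))) * g d' (fst (snd (fst x)) + ((mu - d') * t + sig * snd x)))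
        \<in> borel_measurable (N \<Otimes>\<^sub>M borel)"
      by (rule borel_measurable_sum)
    moreover have "(\<lambda>x. ennreal (al * snd (snd (fst x)))) \<in> borel_measurable (N \<Otimes>\<^sub>M (borel :: real measure))"
      by (intro measurable_compose[OF _ measurable_ennreal] borel_measurable_times borel_measurable_const p(3))
    ultimately show ?thesis
      unfolding f_def case_prod_unfold
      by (intro borel_measurable_times_ennreal[OF p(1)] borel_measurable_add borel_measurable_times_ennreal
          borel_measurable_const)
  qed
  define Z where "Z = (\<lambda>k \<omega>. \<Prod>j\<le>k. indicator {0..} (X j \<omega>) :: ennreal)"
  have Z_01: "Z k \<omega> = 0 \<or> (Z k \<omega> = 1 \<and> 0 \<le> X k \<omega>)" for k \<omega>
  proof (cases "\<forall>j\<le>k. 0 \<le> X j \<omega>")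
    case True
    then show ?thesis by (simp add: Z_def)
  next
    case False
    then obtain j where "j \<le> k" "\<not> 0 \<le> X j \<omega>" by blast
    then have "Z k \<omega> = 0" unfolding Z_def by (intro prod_zero) (auto intro!: bexI[of _ j])
    then show ?thesis ..
  qed
  have Z_Suc: "Z (Suc k) \<omega> = Z k \<omega> * indicator {0..} (X (Suc k) \<omega>)" for k \<omega>
    by (simp add: Z_def)
  let ?F = "\<lambda>k. filt M (Xproc mu sig B x) (real k * t)"
  have le_t: "real j * t \<le> real k * t" if "j \<le> k" for j k :: nat
    using that t by (simp add: mult_right_mono)
  have D_meas': "D j \<in> borel_measurable (?F k)" if "j \<le> k" for j k
    using measurable_filt_mono[OF le_t[OF that] D_meas] .
  have X_meas: "X j \<in> borel_measurable (?F k)" if "j \<le> k" for j k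
  proof -
    have "Xproc mu sig B x (real j * t) \<in> borel_measurable (?F k)"
      using t le_t[OF that] by (intro measurable_filt_process) auto
    moreover have "(\<lambda>\<omega>. t * (\<Sum>i<j. D i \<omega>)) \<in> borel_measurable (?F k)"
      using that by (intro borel_measurable_times borel_measurable_const borel_measurable_sum D_meas') auto
    ultimately have "(\<lambda>\<omega>. Xproc mu sig B x (real j * t) \<omega> - t * (\<Sum>i<j. D i \<omega>)) \<in> borel_measurable (?F k)"
      by (rule borel_measurable_diff)
    then show ?thesis using X by presburger
  qed
  have Z_meas: "Z k \<in> borel_measurable (?F k)" for k
    unfolding Z_def
    by (intro borel_measurable_prod_ennreal measurable_compose[OF X_meas] borel_measurable_indicator) auto
  have kt: "0 \<le> real k * t" for k using t by simp
  have [measurable]: "D k \<in> borel_measurable (completion M)" "X k \<in> borel_measurable (completion M)"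
    "Z k \<in> borel_measurable (completion M)" for k
    by (rule measurable_filt_completion[OF BM kt], rule D_meas X_meas[OF order_refl] Z_meas)+
  have U_meas [measurable]: "(\<lambda>\<omega>. U (X k \<omega>) (D k \<omega>)) \<in> borel_measurable (completion M)" for k
    unfolding U_def
    by (intro borel_measurable_sum borel_measurable_times_ennreal measurable_compose[OF _ g_meas]
        measurable_compose[OF _ ind_meas]) auto
  define r where "r = (\<lambda>k. \<integral>\<^sup>+ \<omega>. Z k \<omega> * ennreal (al * D k \<omega>) \<partial>completion M)"
  define a where "a = (\<lambda>k. \<integral>\<^sup>+ \<omega>. Z k \<omega> * U (X k \<omega>) (D k \<omega>) \<partial>completion M)"
  define Y where "Y = (\<lambda>k \<omega>. (Z k \<omega>, X k \<omega>, D k \<omega>))"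
  have Y_meas: "Y k \<in> ?F k \<rightarrow>\<^sub>M N" for k
    unfolding Y_def N_def by (intro measurable_Pair Z_meas X_meas D_meas order_refl)
  have X_Suc: "X (Suc k) \<omega> = X k \<omega> + ((mu - D k \<omega>) * t + sig * (B (real k * t + t) \<omega> - B (real k * t) \<omega>))" for k \<omega>
    by (simp add: X Xproc_def algebra_simps)
  have "r k + ennreal be * a (Suc k) \<le> a k + ennreal err" for k
  proof -
    have "r k + ennreal be * a (Suc k) = (\<integral>\<^sup>+ \<omega>. Z k \<omega> * ennreal (al * D k \<omega>) +
        ennreal be * (Z (Suc k) \<omega> * U (X (Suc k) \<omega>) (D (Suc k) \<omega>)) \<partial>completion M)"
      unfolding r_def a_def by (subst nn_integral_cmult[symmetric], measurable, subst nn_integral_add) auto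
    also have "\<dots> \<le> (\<integral>\<^sup>+ \<omega>. f (Y k \<omega>, B (real k * t + t) \<omega> - B (real k * t) \<omega>) \<partial>completion M)"
    proof (rule nn_integral_mono)
      fix \<omega> assume "\<omega> \<in> space (completion M)"
      then have om: "\<omega> \<in> space M" by simp
      let ?b = "B (real k * t + t) \<omega> - B (real k * t) \<omega>"
      have "Z (Suc k) \<omega> * U (X (Suc k) \<omega>) (D (Suc k) \<omega>) \<le> Z k \<omega> * g (D k \<omega>) (X (Suc k) \<omega>)"
      proof (cases "0 \<le> X (Suc k) \<omega>")
        case True
        have "W (X (Suc k) \<omega> + eps, D (Suc k) \<omega>) \<le> W (X (Suc k) \<omega> + eps, D k \<omega>)"
          using True eps D_F[OF om, of k] D_F[OF om, of "Suc k"] D_mono[OF om, of k] F by (intro anti) auto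
        then have "g (D (Suc k) \<omega>) (X (Suc k) \<omega>) \<le> g (D k \<omega>) (X (Suc k) \<omega>)"
          using True by (simp add: g_def ennreal_leI)
        then show ?thesis using True by (simp add: Z_Suc U_eq[OF D_F[OF om]] mult_left_mono)
      qed (simp add: Z_Suc)
      moreover have "(\<Sum>d'\<in>F. indicator {d'} (D k \<omega>) * g d' (X k \<omega> + ((mu - d') * t + sig * ?b))) = g (D k \<omega>) (X (Suc k) \<omega>)"
      proof -
        have "(\<Sum>d'\<in>F. indicator {d'} (D k \<omega>) * g d' (X k \<omega> + ((mu - d') * t + sig * ?b))) =
          (\<Sum>d'\<in>F. if d' = D k \<omega> then g (D k \<omega>) (X (Suc k) \<omega>) else 0)"
          unfolding X_Suc by (intro sum.cong) (auto simp: indicator_def)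
        then show ?thesis using D_F[OF om, of k] F(1) by (simp add: sum.delta')
      qed
      ultimately show "Z k \<omega> * ennreal (al * D k \<omega>) + ennreal be * (Z (Suc k) \<omega> * U (X (Suc k) \<omega>) (D (Suc k) \<omega>))
          \<le> f (Y k \<omega>, ?b)"
        unfolding f_def Y_def by (simp add: distrib_left mult.left_commute[of "Z k \<omega>"] mult_left_mono)
    qed
    also have "\<dots> = (\<integral>\<^sup>+ \<omega>. (\<integral>\<^sup>+ b. ennreal (normal_density 0 (sqrt t) b) * f (Y k \<omega>, b) \<partial>lborel) \<partial>completion M)"
      by (rule nn_integral_filt_increment[OF BM kt t Y_meas f_meas])
    also have "\<dots> \<le> (\<integral>\<^sup>+ \<omega>. Z k \<omega> * U (X k \<omega>) (D k \<omega>) + ennreal err \<partial>completion M)"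
    proof (rule nn_integral_mono)
      fix \<omega> assume "\<omega> \<in> space (completion M)"
      then have om: "\<omega> \<in> space M" by simp
      note DF = D_F[OF om, of k]
      \<comment> \<open>Dead paths contribute 0; on surviving ones the surplus is nonnegative, as
        \<open>step\<close> requires.\<close>
      from Z_01[of k \<omega>] show "(\<integral>\<^sup>+ b. ennreal (normal_density 0 (sqrt t) b) * f (Y k \<omega>, b) \<partial>lborel) \<le> Z k \<omega> * U (X k \<omega>) (D k \<omega>) + ennreal err"
      proof
        assume "Z k \<omega> = 0"
        then show ?thesis by (simp add: f_def Y_def)
      next
        assume Z1: "Z k \<omega> = 1 \<and> 0 \<le> X k \<omega>"
        let ?g = "\<lambda>b. g (D k \<omega>) (X k \<omega> + ((mu - D k \<omega>) * t + sig * b))"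
        have f_eq: "f (Y k \<omega>, b) = ennreal (al * D k \<omega>) + ennreal be * ?g b" for b
        proof -
          have "(\<Sum>d'\<in>F. indicator {d'} (D k \<omega>) * g d' (X k \<omega> + ((mu - d') * t + sig * b))) =
            (\<Sum>d'\<in>F. if d' = D k \<omega> then ?g b else 0)"
            by (intro sum.cong) (auto simp: indicator_def)
          then show ?thesis using DF F(1) Z1 by (simp add: sum.delta' f_def Y_def)
        qed
        have [measurable]: "?g \<in> borel_measurable borel"
          by (rule measurable_compose[OF _ g_meas[OF DF]]) measurable
        have nd: "(\<integral>\<^sup>+ b. ennreal (normal_density 0 (sqrt t) b) \<partial>lborel) = 1"
          using t by (subst nn_integral_eq_integral) auto
        have "(\<integral>\<^sup>+ b. ennreal (normal_density 0 (sqrt t) b) * f (Y k \<omega>, b) \<partial>lborel) =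
          (\<integral>\<^sup>+ b. ennreal (al * D k \<omega>) * ennreal (normal_density 0 (sqrt t) b) +
            ennreal be * (ennreal (normal_density 0 (sqrt t) b) * ?g b) \<partial>lborel)"
          unfolding f_eq by (simp add: distrib_left mult_ac)
        also have "\<dots> = ennreal (al * D k \<omega>) * (\<integral>\<^sup>+ b. ennreal (normal_density 0 (sqrt t) b) \<partial>lborel) +
            ennreal be * (\<integral>\<^sup>+ b. ennreal (normal_density 0 (sqrt t) b) * ?g b \<partial>lborel)"
          by (subst nn_integral_add, measurable, subst nn_integral_cmult, measurable, subst nn_integral_cmult, measurable)
        also have "\<dots> = ennreal (D k \<omega> * (1 - exp (- q * t)) / q) + ennreal (exp (- q * t)) *
            (\<integral>\<^sup>+ b. ennreal (normal_density 0 (sqrt t) b) *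
              ennreal (if 0 \<le> X k \<omega> + ((mu - D k \<omega>) * t + sig * b) then W (X k \<omega> + ((mu - D k \<omega>) * t + sig * b) + eps, D k \<omega>) else 0) \<partial>lborel)"
          unfolding nd g_def al_def be_def atLeast_iff mult_1_right
          by (simp only: mult.commute[of "D k \<omega>"] times_divide_eq_left)
        also have "\<dots> \<le> ennreal (W (X k \<omega> + eps, D k \<omega>)) + ennreal err"
          using Z1 DF by (intro step) auto
        also have "ennreal (W (X k \<omega> + eps, D k \<omega>)) = Z k \<omega> * U (X k \<omega>) (D k \<omega>)"
          using Z1 by (simp add: U_eq[OF DF] g_def)
        finally show ?thesis .
      qed
    qed
    also have "\<dots> = a k + ennreal err"
      unfolding a_def by (subst nn_integral_add) (auto simp: C.emeasure_space_1[simplified])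
    finally show ?thesis .
  qed
  then have "(\<Sum>k. ennreal (be ^ k) * r k) \<le> a 0 + ennreal (err / (1 - be))"
    by (rule discounted_recursion_bound[where r = r and a = a, OF be err])
  also have "a 0 \<le> ennreal (W (x + eps, c))"
  proof -
    have "a 0 \<le> (\<integral>\<^sup>+ \<omega>. ennreal (W (x + eps, c)) \<partial>completion M)"
      unfolding a_def
    proof (rule nn_integral_mono)
      fix \<omega> assume "\<omega> \<in> space (completion M)"
      then have om: "\<omega> \<in> space M" by simp
      have X0: "X 0 \<omega> = x" using BM om by (simp add: X Xproc_def std_BM_def)
      have "W (x + eps, D 0 \<omega>) \<le> W (x + eps, c)"
        using D_0[OF om] D_F[OF om, of 0] F c x eps by (intro anti) auto
      then show "Z 0 \<omega> * U (X 0 \<omega>) (D 0 \<omega>) \<le> ennreal (W (x + eps, c))"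
        using x by (simp add: Z_def X0 U_eq[OF D_F[OF om]] g_def ennreal_leI)
    qed
    then show ?thesis using C.emeasure_space_1 by simp
  qed
  finally show ?thesis unfolding r_def Z_def al_def be_def by simp
qed

lemma grid_rounding:
  fixes c chi :: real and n :: nat
  assumes "c < chi" "0 < n"
  obtains rd :: "real \<Rightarrow> real" and F where "finite F" "F \<subseteq> {c..<chi}" "rd \<in> borel_measurable borel"
    "mono_on {c..chi} rd"
    "\<And>v. c \<le> v \<Longrightarrow> v \<le> chi \<Longrightarrow> rd v \<in> F \<and> rd v \<le> v \<and> v \<le> rd v + (chi - c) / real n"
proof -
  define de where "de = (chi - c) / real n"
  have de: "0 < de" and n_de: "real n * de = chi - c" using assms by (auto simp: de_def)
  \<comment> \<open>The cap acts on the range only at v = chi, which it sends to the last grid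
    value; all rounded levels thus stay below \<open>chi\<close>, with an error still of one
    mesh.\<close>
  define ix where "ix = (\<lambda>v. min \<lfloor>(v - c) / de\<rfloor> (int n - 1))"
  define rd where "rd = (\<lambda>v. c + de * of_int (ix v))"
  define F where "F = (\<lambda>i. c + de * real i) ` {..<n}"
  show thesis
  proof (rule that[of F rd])
    show "finite F" by (simp add: F_def)
    show "F \<subseteq> {c..<chi}"
    proof
      fix d assume "d \<in> F"
      then obtain i where i: "i < n" "d = c + de * real i" by (auto simp: F_def)
      have "de * real i < real n * de" "0 \<le> de * real i" using i de by (auto simp: mult.commute)
      then show "d \<in> {c..<chi}" unfolding i(2) n_de by simp
    qed
    show "rd \<in> borel_measurable borel"
      unfolding rd_def ix_def by measurable
    show "mono_on {c..chi} rd"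
    proof (rule mono_onI)
      fix u v :: real assume "u \<le> v"
      then have "ix u \<le> ix v"
        unfolding ix_def using de by (intro min.mono floor_mono divide_right_mono) auto
      then show "rd u \<le> rd v" using de by (simp add: rd_def)
    qed
    fix v assume v: "c \<le> v" "v \<le> chi"
    have ix: "0 \<le> ix v" "ix v < int n" using v de assms by (auto simp: ix_def)
    have "real_of_int (ix v) \<le> (v - c) / de"
      using le_floor_iff[of "ix v" "(v - c) / de"] by (simp add: ix_def)
    then have "rd v \<le> v" using de by (simp add: rd_def divide_simps mult.commute)
    moreover have "(v - c) / de \<le> of_int (ix v) + 1"
    proof (cases "\<lfloor>(v - c) / de\<rfloor> \<le> int n - 1")
      case True
      then have "ix v = \<lfloor>(v - c) / de\<rfloor>" by (simp add: ix_def)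
      then show ?thesis by linarith
    next
      case False
      have "(v - c) / de \<le> real n" using v de n_de by (simp add: divide_simps)
      then show ?thesis using False by (simp add: ix_def)
    qed
    then have "v \<le> rd v + de" using de by (simp add: rd_def divide_simps algebra_simps)
    moreover have "rd v \<in> F"
      unfolding F_def rd_def by (rule image_eqI[of _ _ "nat (ix v)"]) (use ix in auto)
    ultimately show "rd v \<in> F \<and> rd v \<le> v \<and> v \<le> rd v + (chi - c) / real n"
      unfolding de_def[symmetric] by simp
  qed
qed

section \<open>Verification\<close>

text \<open>The error terms have separate origins: err / (1 - exp (- q * t)) accumulates the
  one-step errors, de / q is the rounding of levels, and t * chi is the freezing between grid
  times.\<close>

lemma Jval_le_grid:
  fixes B :: "real \<Rightarrow> 'a \<Rightarrow> real"
  assumes BM: "std_BM M B" and t: "0 < t" and q: "0 < q" and x: "0 \<le> x" and clo: "0 \<le> clo"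
    and c: "clo \<le> c" "c < chi" and C: "C \<in> admissible M mu sig B {clo..chi} x c"
    and F: "finite F" "F \<subseteq> {c..<chi}" and eps: "0 < eps" and err: "0 \<le> err" and de: "0 \<le> de"
    and rd: "rd \<in> borel_measurable borel" "mono_on {c..chi} rd"
      "\<And>v. c \<le> v \<Longrightarrow> v \<le> chi \<Longrightarrow> rd v \<in> F \<and> rd v \<le> v \<and> v \<le> rd v + de"
    and W0: "0 \<le> W (x + eps, c)"
    and anti: "\<And>y d d'. 0 < y \<Longrightarrow> clo \<le> d \<Longrightarrow> d \<le> d' \<Longrightarrow> d' < chi \<Longrightarrow> W (y, d') \<le> W (y, d)"
    and cont: "\<And>d. d \<in> F \<Longrightarrow> continuous_on {0..} (\<lambda>y. W (y, d))"
    and step: "\<And>y d. 0 \<le> y \<Longrightarrow> d \<in> F \<Longrightarrow>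
      ennreal (d * (1 - exp (- q * t)) / q) + ennreal (exp (- q * t)) *
        (\<integral>\<^sup>+ b. ennreal (normal_density 0 (sqrt t) b) *
           ennreal (if 0 \<le> y + ((mu - d) * t + sig * b) then W (y + ((mu - d) * t + sig * b) + eps, d) else 0) \<partial>lborel)
      \<le> ennreal (W (y + eps, d)) + ennreal err"
  shows "Jval M mu sig q B x C \<le> W (x + eps, c) + err / (1 - exp (- q * t)) + (de / q + t * chi)"
proof -
  interpret M: prob_space M using BM by (simp add: std_BM_def)
  interpret Co: prob_space "completion M" by (rule prob_space_completion) (rule M.prob_space_axioms)
  have C_mono: "mono_on {0..} (\<lambda>s. C s \<omega>)" and C_rng: "0 \<le> s \<Longrightarrow> c \<le> C s \<omega> \<and> C s \<omega> \<le> chi"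
    if "\<omega> \<in> space M" for \<omega> s
    using C that by (auto simp: admissible_def)
  have C_meas: "C s \<in> borel_measurable (filt M (Xproc mu sig B x) s)" if "0 \<le> s" for s
    using C that by (auto simp: admissible_def)
  have kt: "0 \<le> real k * t" for k using t by simp
  define D where "D = (\<lambda>k \<omega>. rd (C (real k * t) \<omega>))"
  define X where "X = (\<lambda>k \<omega>. Xproc mu sig B x (real k * t) \<omega> - t * (\<Sum>j<k. D j \<omega>))"
  have D: "D k \<omega> \<in> F" "D k \<omega> \<le> C (real k * t) \<omega>" "C (real k * t) \<omega> \<le> D k \<omega> + de" if "\<omega> \<in> space M" for k \<omega>
    using rd(3) C_rng[OF that kt] by (auto simp: D_def)
  have D_ge: "c \<le> D k \<omega>" "0 \<le> D k \<omega>" if "\<omega> \<in> space M" for k \<omega>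
    using D(1)[OF that, of k] F c clo by auto
  have D_mono: "D k \<omega> \<le> D (Suc k) \<omega>" if "\<omega> \<in> space M" for k \<omega>
  proof -
    have "C (real k * t) \<omega> \<le> C (real (Suc k) * t) \<omega>"
      using t by (intro mono_onD[OF C_mono[OF that]]) (auto simp: mult_right_mono)
    then show ?thesis unfolding D_def
      using C_rng[OF that kt[of k]] C_rng[OF that kt[of "Suc k"]]
      by (intro mono_onD[OF rd(2)]) (auto simp del: of_nat_Suc)
  qed
  have D_meas: "D k \<in> borel_measurable (filt M (Xproc mu sig B x) (real k * t))" for k
    unfolding D_def by (rule measurable_compose[OF C_meas[OF kt] rd(1)])
  let ?R = "\<lambda>k \<omega>. (\<Prod>j\<le>k. indicator {0..} (X j \<omega>)) * ennreal ((1 - exp (- q * t)) / q * D k \<omega>)"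
  have X_meas: "X j \<in> borel_measurable (completion M)" and D_meas': "D j \<in> borel_measurable (completion M)" for j
  proof -
    show D': "D j \<in> borel_measurable (completion M)" for j
      by (rule measurable_filt_completion[OF BM kt D_meas])
    have "Xproc mu sig B x (real j * t) \<in> borel_measurable (completion M)"
      by (rule measurable_filt_completion[OF BM kt measurable_filt_process[OF kt order_refl]])
    then show "X j \<in> borel_measurable (completion M)"
      unfolding X_def using D' by (intro borel_measurable_diff borel_measurable_times borel_measurable_sum) auto
  qed
  have R_meas: "?R k \<in> borel_measurable (completion M)" for k
  proof (intro borel_measurable_times_ennreal borel_measurable_prod_ennreal)
    show "(\<lambda>\<omega>. ennreal ((1 - exp (- q * t)) / q * D k \<omega>)) \<in> borel_measurable (completion M)"
      by (intro measurable_compose[OF _ measurable_ennreal] borel_measurable_times borel_measurable_const D_meas')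
    show "(\<lambda>\<omega>. indicator {0..} (X j \<omega>)) \<in> borel_measurable (completion M)" for j
      by (intro measurable_compose[OF X_meas] borel_measurable_indicator) simp
  qed
  let ?J = "\<integral>\<^sup>+ \<omega>. (\<integral>\<^sup>+ s. indicator {s. 0 \<le> s \<and> ereal s < ruin_time mu sig B x C \<omega>} s
              * ennreal (exp (- q * s) * C s \<omega>) \<partial>lborel) \<partial>M"
  have "?J \<le> (\<integral>\<^sup>+ \<omega>. (\<Sum>k. ennreal (exp (- q * t) ^ k) * ?R k \<omega>) + ennreal (de / q + t * chi) \<partial>M)"
  proof (rule nn_integral_mono)
    fix \<omega> assume om: "\<omega> \<in> space M"
    show "(\<integral>\<^sup>+ s. indicator {s. 0 \<le> s \<and> ereal s < ruin_time mu sig B x C \<omega>} s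
              * ennreal (exp (- q * s) * C s \<omega>) \<partial>lborel) \<le> (\<Sum>k. ennreal (exp (- q * t) ^ k) * ?R k \<omega>) + ennreal (de / q + t * chi)"
      unfolding ruin_time_def surplus_def
    proof (rule grid_path_bound[OF q t de])
      show "mono_on {0..} (\<lambda>s. C s \<omega>)" by (rule C_mono[OF om])
      show "0 \<le> C s \<omega>" "C s \<omega> \<le> chi" if "0 \<le> s" for s using C_rng[OF om that] c clo by auto
    qed (use D[OF om] D_ge[OF om] in \<open>auto simp: X_def\<close>)
  qed
  \<comment> \<open>The payoff is an integral over \<open>M\<close>, but measurability of the grid
    quantities is available in the completion; nonnegative integrals agree for both.\<close>
  also have "\<dots> = (\<integral>\<^sup>+ \<omega>. (\<Sum>k. ennreal (exp (- q * t) ^ k) * ?R k \<omega>) + ennreal (de / q + t * chi) \<partial>completion M)"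
    by (rule nn_integral_completion[symmetric])
  also have "\<dots> = (\<integral>\<^sup>+ \<omega>. (\<Sum>k. ennreal (exp (- q * t) ^ k) * ?R k \<omega>) \<partial>completion M) + ennreal (de / q + t * chi)"
    using R_meas Co.emeasure_space_1
    by (subst nn_integral_add) (auto intro!: borel_measurable_suminf_order borel_measurable_times_ennreal)
  also have "(\<integral>\<^sup>+ \<omega>. (\<Sum>k. ennreal (exp (- q * t) ^ k) * ?R k \<omega>) \<partial>completion M)
     = (\<Sum>k. \<integral>\<^sup>+ \<omega>. ennreal (exp (- q * t) ^ k) * ?R k \<omega> \<partial>completion M)"
    by (rule nn_integral_suminf) (intro borel_measurable_times_ennreal borel_measurable_const R_meas)
  also have "\<dots> = (\<Sum>k. ennreal (exp (- q * t) ^ k) * (\<integral>\<^sup>+ \<omega>. ?R k \<omega> \<partial>completion M))"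
    by (intro suminf_cong nn_integral_cmult R_meas)
  also have "\<dots> \<le> ennreal (W (x + eps, c)) + ennreal (err / (1 - exp (- q * t)))"
    by (rule grid_value_le[OF BM t q x F(1) _ eps err anti cont step c])
      (use F c D D_mono D_ge D_meas in \<open>auto simp: X_def\<close>)
  finally have "?J \<le> ennreal (W (x + eps, c)) + ennreal (err / (1 - exp (- q * t))) + ennreal (de / q + t * chi)"
    by (simp add: add_right_mono)
  also have "\<dots> = ennreal (W (x + eps, c) + err / (1 - exp (- q * t)) + (de / q + t * chi))"
    using W0 err de q t c clo by (simp add: ennreal_plus)
  finally have "enn2real ?J \<le> W (x + eps, c) + err / (1 - exp (- q * t)) + (de / q + t * chi)"
    using W0 err de q t c clo by (intro enn2real_leI) auto
  then show ?thesis by (simp add: Jval_def)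
qed

lemma Jval_le_visc_super:
  fixes B :: "real \<Rightarrow> 'a \<Rightarrow> real"
  assumes BM: "std_BM M B" and sig: "0 < sig" and q: "0 < q" and clo: "0 \<le> clo"
    and vs: "visc_super mu sig q clo chi W"
    and nn: "\<And>x c. 0 \<le> x \<Longrightarrow> clo \<le> c \<Longrightarrow> c < chi \<Longrightarrow> 0 \<le> W (x, c)"
    and bd: "\<And>x c. 0 \<le> x \<Longrightarrow> clo \<le> c \<Longrightarrow> c < chi \<Longrightarrow> W (x, c) \<le> chi / q"
    and x: "0 \<le> x" and c: "clo \<le> c" "c < chi" and C: "C \<in> admissible M mu sig B {clo..chi} x c"
  shows "Jval M mu sig q B x C \<le> W (x, c)"
proof -
  have W_cont: "continuous_on ({0..} \<times> {clo..<chi}) W"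
    using vs by (auto simp: visc_super_def intro: loc_lipschitz_on_imp_continuous_on)
  have cont: "continuous_on {0..} (\<lambda>y. W (y, d))" if "clo \<le> d" "d < chi" for d
    using that by (intro continuous_on_compose2[OF W_cont] continuous_intros) auto
  have grid: "Jval M mu sig q B x C \<le> W (x + eps, c) + (chi - c) / real n / q" if eps: "0 < eps" and n: "0 < n" for eps n
  proof -
    obtain rd :: "real \<Rightarrow> real" and F where F: "finite F" "F \<subseteq> {c..<chi}" and rd: "rd \<in> borel_measurable borel"
      "mono_on {c..chi} rd" "\<And>v. c \<le> v \<Longrightarrow> v \<le> chi \<Longrightarrow> rd v \<in> F \<and> rd v \<le> v \<and> v \<le> rd v + (chi - c) / real n"
      by (rule grid_rounding[OF c(2) n]) (rule that)
    have FD: "clo \<le> d" "d < chi" if "d \<in> F" for d using that F c by auto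
    let ?L = "\<lambda>d y t. ennreal (d * (1 - exp (- q * t)) / q) + ennreal (exp (- q * t)) *
        (\<integral>\<^sup>+ b. ennreal (normal_density 0 (sqrt t) b) *
           ennreal (if 0 \<le> y + ((mu - d) * t + sig * b) then W (y + ((mu - d) * t + sig * b) + eps, d) else 0) \<partial>lborel)"
    let ?R = "\<lambda>K d y t. ennreal (W (y + eps, d)) + ennreal (K * exp (- eps / sqrt t))"
    have "\<exists>K. 0 \<le> K \<and> (\<forall>y t. 0 \<le> y \<longrightarrow> 0 < t \<longrightarrow> t \<le> 1 \<longrightarrow> ?L d y t \<le> ?R K d y t)" if "d \<in> F" for d
    proof (rule visc_super_one_step[OF vs nn bd q sig clo FD[OF that] eps])
      fix K assume K: "0 \<le> K" and S: "\<And>y t. 0 \<le> y \<Longrightarrow> 0 < t \<Longrightarrow> t \<le> 1 \<Longrightarrow> ?L d y t \<le> ?R K d y t"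
      show ?thesis by (intro exI[of _ K] conjI allI impI K S)
    qed
    then have "\<exists>Kf. \<forall>d\<in>F. 0 \<le> Kf d \<and> (\<forall>y t. 0 \<le> y \<longrightarrow> 0 < t \<longrightarrow> t \<le> 1 \<longrightarrow> ?L d y t \<le> ?R (Kf d) d y t)"
      by (intro bchoice ballI)
    then obtain Kf where Kf: "\<forall>d\<in>F. 0 \<le> Kf d \<and> (\<forall>y t. 0 \<le> y \<longrightarrow> 0 < t \<longrightarrow> t \<le> 1 \<longrightarrow> ?L d y t \<le> ?R (Kf d) d y t)" ..
    have Kf_nn: "0 \<le> Kf d" if "d \<in> F" for d by (rule conjunct1[OF bspec[OF Kf that]])
    \<comment> \<open>One constant for all levels of the finite set \<open>F\<close>. It depends on
      \<open>eps\<close> and n but is chosen before t.\<close>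
    define K where "K = (\<Sum>d\<in>F. Kf d)"
    have K: "Kf d \<le> K" if "d \<in> F" for d
      using Kf_nn F(1) that unfolding K_def by (intro member_le_sum) auto
    have K0: "0 \<le> K" using Kf_nn unfolding K_def by (intro sum_nonneg)
    have le: "Jval M mu sig q B x C \<le> W (x + eps, c) + K * exp (- eps / sqrt t) / (1 - exp (- q * t)) +
        ((chi - c) / real n / q + t * chi)" if t: "0 < t" "t \<le> 1" for t
    proof (rule Jval_le_grid[OF BM t(1) q x clo c C F eps _ _ rd])
      show "0 \<le> K * exp (- eps / sqrt t)" using K0 by simp
      show "0 \<le> (chi - c) / real n" using c by simp
      show "0 \<le> W (x + eps, c)" using nn x eps c by simp
      show "W (y, d') \<le> W (y, d)" if "0 < y" "clo \<le> d" "d \<le> d'" "d' < chi" for y d d'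
        by (rule visc_super_antimono[OF vs nn that])
      show "continuous_on {0..} (\<lambda>y. W (y, d))" if "d \<in> F" for d by (rule cont[OF FD[OF that]])
      fix y d assume y: "0 \<le> (y :: real)" and d: "d \<in> F"
      have "ennreal (W (y + eps, d)) + ennreal (Kf d * exp (- eps / sqrt t)) \<le>
          ennreal (W (y + eps, d)) + ennreal (K * exp (- eps / sqrt t))"
        using K[OF d] by (intro add_left_mono ennreal_leI mult_right_mono) auto
      with conjunct2[OF bspec[OF Kf d], rule_format, OF y t]
      show "ennreal (d * (1 - exp (- q * t)) / q) + ennreal (exp (- q * t)) *
        (\<integral>\<^sup>+ b. ennreal (normal_density 0 (sqrt t) b) *
           ennreal (if 0 \<le> y + ((mu - d) * t + sig * b) then W (y + ((mu - d) * t + sig * b) + eps, d) else 0) \<partial>lborel)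
        \<le> ennreal (W (y + eps, d)) + ennreal (K * exp (- eps / sqrt t))"
        by (rule order_trans)
    qed
    show ?thesis
    proof (rule tendsto_lowerbound)
      \<comment> \<open>The numerator decays faster than any power of t, while the denominator is of
        order t.\<close>
      have "((\<lambda>t. exp (- eps / sqrt t) / (1 - exp (- q * t))) \<longlongrightarrow> 0) (at_right 0)"
        using eps q by real_asymp
      then have "((\<lambda>t. W (x + eps, c) + K * (exp (- eps / sqrt t) / (1 - exp (- q * t))) + ((chi - c) / real n / q + t * chi))
          \<longlongrightarrow> W (x + eps, c) + K * 0 + ((chi - c) / real n / q + 0 * chi)) (at_right 0)"
        by (intro tendsto_intros)
      then show "((\<lambda>t. W (x + eps, c) + K * (exp (- eps / sqrt t) / (1 - exp (- q * t))) + ((chi - c) / real n / q + t * chi))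
          \<longlongrightarrow> W (x + eps, c) + (chi - c) / real n / q) (at_right 0)" by simp
      have "\<forall>\<^sub>F t in at_right (0::real). t \<in> {0<..<1}" by (rule eventually_at_right_real) simp
      then show "\<forall>\<^sub>F t in at_right 0. Jval M mu sig q B x C \<le>
          W (x + eps, c) + K * (exp (- eps / sqrt t) / (1 - exp (- q * t))) + ((chi - c) / real n / q + t * chi)"
        by eventually_elim (use le in auto)
    qed simp
  qed
  have shift: "Jval M mu sig q B x C \<le> W (x + eps, c)" if eps: "0 < eps" for eps
  proof (rule tendsto_lowerbound)
    have "(\<lambda>n. W (x + eps, c) + (chi - c) / real n / q) \<longlonglongrightarrow> W (x + eps, c) + 0 / q"
      using q by (intro tendsto_intros lim_const_over_n) auto
    then show "(\<lambda>n. W (x + eps, c) + (chi - c) / real n / q) \<longlonglongrightarrow> W (x + eps, c)" by simp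
    show "\<forall>\<^sub>F n in sequentially. Jval M mu sig q B x C \<le> W (x + eps, c) + (chi - c) / real n / q"
      using eventually_gt_at_top[of 0] by eventually_elim (rule grid[OF eps])
  qed simp
  show ?thesis
  proof (rule tendsto_lowerbound)
    \<comment> \<open>W is continuous up to the boundary, so the shift can be removed from the right
      even at x = 0.\<close>
    have "((\<lambda>y. W (y, c)) \<longlongrightarrow> W (x, c)) (at x within {0..})"
      using cont[OF c] x by (simp add: continuous_on_def)
    then have "((\<lambda>y. W (y, c)) \<longlongrightarrow> W (x, c)) (at_right x)"
      by (rule tendsto_within_subset) (use x in auto)
    then show "((\<lambda>y. W (y, c)) \<longlongrightarrow> W (x, c)) (at_right x)" .
    show "\<forall>\<^sub>F y in at_right x. Jval M mu sig q B x C \<le> W (y, c)"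
      using eventually_at_right_less[of x]
    proof eventually_elim
      case (elim y)
      then show ?case using shift[of "y - x"] by simp
    qed
  qed simp
qed

section \<open>Payoff bounds, the top level and the identification of W\<close>

lemma Jval_bounds:
  assumes BM: "std_BM M B" and q: "0 < q" and chi: "0 \<le> chi"
    and C: "C \<in> admissible M mu sig B {clo..chi} x c"
  shows "0 \<le> Jval M mu sig q B x C" "Jval M mu sig q B x C \<le> chi / q"
proof -
  show "0 \<le> Jval M mu sig q B x C" by (simp add: Jval_def)
  have "prob_space M" using BM by (simp add: std_BM_def)
  moreover have "C s \<omega> \<le> chi" if "\<omega> \<in> space M" "0 \<le> s" for \<omega> s
    using C that by (auto simp: admissible_def)
  ultimately show "Jval M mu sig q B x C \<le> chi / q"
    unfolding Jval_def using q chi by (intro enn2real_leI Jval_integral_le) auto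
qed

lemma Jval_cong:
  assumes "\<And>\<omega> s. \<omega> \<in> space M \<Longrightarrow> 0 \<le> s \<Longrightarrow> C s \<omega> = C' s \<omega>"
  shows "Jval M mu sig q B x C = Jval M mu sig q B x C'"
proof -
  have "ruin_time mu sig B x C \<omega> = ruin_time mu sig B x C' \<omega>" if "\<omega> \<in> space M" for \<omega>
  proof -
    have "integral {0..t} (\<lambda>s. C s \<omega>) = integral {0..t} (\<lambda>s. C' s \<omega>)" for t
      using assms[OF that] by (intro Henstock_Kurzweil_Integration.integral_cong) auto
    then show ?thesis by (simp add: ruin_time_def surplus_def)
  qed
  then show ?thesis unfolding Jval_def using assms
    by (intro arg_cong[where f = enn2real] nn_integral_cong) (auto simp: indicator_def)
qed

text \<open>At the top level the constraints force C = chi at all nonnegative times, and the payoff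
  sees no other times. This settles the level at which no equation is assumed.\<close>

lemma Jval_eq_if_admissible_max:
  assumes "C \<in> admissible M mu sig B {clo..chi} x chi" "C' \<in> admissible M mu sig B {clo..chi} x chi"
  shows "Jval M mu sig q B x C = Jval M mu sig q B x C'"
proof (rule Jval_cong)
  fix \<omega> s assume "\<omega> \<in> space M" "(0::real) \<le> s"
  then have "C s \<omega> = chi" "C' s \<omega> = chi"
    using assms by (auto simp: admissible_def intro!: antisym)
  then show "C s \<omega> = C' s \<omega>" by simp
qed

text \<open>Both claims are instances, a single family being a constant sequence. The uniform bound
  on payoffs makes the real supremum meaningful, and passing it to the limit supplies 0 \<le> W
  \<le> chi / q for the comparison.\<close>

lemma visc_super_limit_eq_Vval:
  fixes B :: "real \<Rightarrow> 'a \<Rightarrow> real" and Ck :: "nat \<Rightarrow> real \<Rightarrow> real \<Rightarrow> real \<Rightarrow> 'a \<Rightarrow> real"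
  assumes BM: "std_BM M B" and sig: "0 < sig" and q: "0 < q" and clo: "0 \<le> clo" "clo < chi"
    and vs: "visc_super mu sig q clo chi W"
    and adm: "\<And>k x c. 1 \<le> k \<Longrightarrow> 0 \<le> x \<Longrightarrow> clo \<le> c \<Longrightarrow> c \<le> chi \<Longrightarrow> Ck k x c \<in> admissible M mu sig B {clo..chi} x c"
    and lim: "\<And>x c. 0 \<le> x \<Longrightarrow> clo \<le> c \<Longrightarrow> c \<le> chi \<Longrightarrow> (\<lambda>k. Jval M mu sig q B x (Ck k x c)) \<longlonglongrightarrow> W (x, c)"
    and x: "0 \<le> x" and c: "clo \<le> c" "c \<le> chi"
  shows "W (x, c) = Vval M mu sig q B {clo..chi} x c"
proof (rule antisym)
  let ?A = "admissible M mu sig B {clo..chi} x c"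
  have chi: "0 \<le> chi" using clo by simp
  note J_bd = Jval_bounds[OF BM q chi]
  have bdd: "bdd_above (Jval M mu sig q B x ` ?A)"
    using J_bd(2) by (intro bdd_aboveI2)
  have ev: "\<forall>\<^sub>F k in sequentially. Ck k y d \<in> admissible M mu sig B {clo..chi} y d"
    if "0 \<le> y" "clo \<le> d" "d \<le> chi" for y d
    using eventually_ge_at_top[of 1] by eventually_elim (rule adm[OF _ that])
  show "W (x, c) \<le> Vval M mu sig q B {clo..chi} x c"
    unfolding Vval_def
  proof (rule tendsto_upperbound[OF lim[OF x c]])
    show "\<forall>\<^sub>F k in sequentially. Jval M mu sig q B x (Ck k x c) \<le> (SUP C\<in>?A. Jval M mu sig q B x C)"
      using ev[OF x c] by eventually_elim (rule cSUP_upper[OF _ bdd])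
  qed simp
  have W_bd: "0 \<le> W (y, d)" "W (y, d) \<le> chi / q" if "0 \<le> y" "clo \<le> d" "d < chi" for y d
  proof -
    have d: "d \<le> chi" using that by simp
    have "\<forall>\<^sub>F k in sequentially. 0 \<le> Jval M mu sig q B y (Ck k y d) \<and> Jval M mu sig q B y (Ck k y d) \<le> chi / q"
      using ev[OF that(1,2) d] by eventually_elim (use J_bd in blast)
    then show "0 \<le> W (y, d)" "W (y, d) \<le> chi / q"
      by (auto intro: tendsto_lowerbound[OF lim[OF that(1,2) d]] tendsto_upperbound[OF lim[OF that(1,2) d]]
          elim: eventually_mono)
  qed
  show "Vval M mu sig q B {clo..chi} x c \<le> W (x, c)"
    unfolding Vval_def
  proof (rule cSUP_least)
    show "?A \<noteq> {}" using adm[OF order_refl x c] by blast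
    fix C assume C: "C \<in> ?A"
    show "Jval M mu sig q B x C \<le> W (x, c)"
    proof (cases "c = chi")
      case False
      then show ?thesis using c C x by (intro Jval_le_visc_super[OF BM sig q clo(1) vs W_bd]) auto
    next
      case True
      have "\<forall>\<^sub>F k in sequentially. Jval M mu sig q B x C \<le> Jval M mu sig q B x (Ck k x c)"
        using ev[OF x c]
      proof eventually_elim
        case (elim k)
        then show ?case
          using Jval_eq_if_admissible_max[of C M mu sig B clo chi x "Ck k x c" q] C unfolding True by simp
      qed
      then show ?thesis by (rule tendsto_lowerbound[OF lim[OF x c]]) simp
    qed
  qed
qed

theorem mainTheorem7:
  fixes M :: "'a measure" and B :: "real \<Rightarrow> 'a \<Rightarrow> real"
    and mu sig q clo chi :: real
  assumes "std_BM M B" and "0 < mu" and "0 < sig" and "0 < q"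
    and "0 \<le> clo" and "clo < chi"
  shows "(\<forall>Cf :: real \<Rightarrow> real \<Rightarrow> (real \<Rightarrow> 'a \<Rightarrow> real).
            (\<forall>x\<ge>0. \<forall>c\<in>{clo..chi}. Cf x c \<in> admissible M mu sig B {clo..chi} x c) \<and>
            visc_super mu sig q clo chi (\<lambda>(x, c). Jval M mu sig q B x (Cf x c)) \<and>
            (\<forall>c\<in>{clo..chi}. Jval M mu sig q B 0 (Cf 0 c) = 0) \<and>
            (\<forall>c\<in>{clo..chi}. ((\<lambda>x. Jval M mu sig q B x (Cf x c)) \<longlongrightarrow> chi / q) at_top)
            \<longrightarrow> (\<forall>x\<ge>0. \<forall>c\<in>{clo..chi}.
                  Jval M mu sig q B x (Cf x c) = Vval M mu sig q B {clo..chi} x c))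
       \<and> (\<forall>(Ck :: nat \<Rightarrow> real \<Rightarrow> real \<Rightarrow> (real \<Rightarrow> 'a \<Rightarrow> real)) (W :: real \<times> real \<Rightarrow> real).
            (\<forall>k\<ge>1. \<forall>x\<ge>0. \<forall>c\<in>{clo..chi}. Ck k x c \<in> admissible M mu sig B {clo..chi} x c) \<and>
            (\<forall>x\<ge>0. \<forall>c\<in>{clo..chi}.
               ((\<lambda>k. Jval M mu sig q B x (Ck k x c)) \<longlongrightarrow> W (x, c)) sequentially) \<and>
            visc_super mu sig q clo chi W \<and>
            (\<forall>c\<in>{clo..chi}. W (0, c) = 0) \<and>
            (\<forall>c\<in>{clo..chi}. ((\<lambda>x. W (x, c)) \<longlongrightarrow> chi / q) at_top)
            \<longrightarrow> (\<forall>x\<ge>0. \<forall>c\<in>{clo..chi}. W (x, c) = Vval M mu sig q B {clo..chi} x c))"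
proof (intro conjI allI ballI impI)
  fix Cf :: "real \<Rightarrow> real \<Rightarrow> real \<Rightarrow> 'a \<Rightarrow> real" and x c :: real
  assume H: "(\<forall>x\<ge>0. \<forall>c\<in>{clo..chi}. Cf x c \<in> admissible M mu sig B {clo..chi} x c) \<and>
            visc_super mu sig q clo chi (\<lambda>(x, c). Jval M mu sig q B x (Cf x c)) \<and>
            (\<forall>c\<in>{clo..chi}. Jval M mu sig q B 0 (Cf 0 c) = 0) \<and>
            (\<forall>c\<in>{clo..chi}. ((\<lambda>x. Jval M mu sig q B x (Cf x c)) \<longlongrightarrow> chi / q) at_top)"
    and x: "0 \<le> x" and c: "c \<in> {clo..chi}"
  show "Jval M mu sig q B x (Cf x c) = Vval M mu sig q B {clo..chi} x c"
    using visc_super_limit_eq_Vval[OF assms(1,3-6), of mu "\<lambda>(x, c). Jval M mu sig q B x (Cf x c)" "\<lambda>_. Cf" x c]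
      H x c by simp
next
  fix Ck :: "nat \<Rightarrow> real \<Rightarrow> real \<Rightarrow> real \<Rightarrow> 'a \<Rightarrow> real" and W :: "real \<times> real \<Rightarrow> real" and x c :: real
  assume H: "(\<forall>k\<ge>1. \<forall>x\<ge>0. \<forall>c\<in>{clo..chi}. Ck k x c \<in> admissible M mu sig B {clo..chi} x c) \<and>
            (\<forall>x\<ge>0. \<forall>c\<in>{clo..chi}.
               ((\<lambda>k. Jval M mu sig q B x (Ck k x c)) \<longlongrightarrow> W (x, c)) sequentially) \<and>
            visc_super mu sig q clo chi W \<and>
            (\<forall>c\<in>{clo..chi}. W (0, c) = 0) \<and>
            (\<forall>c\<in>{clo..chi}. ((\<lambda>x. W (x, c)) \<longlongrightarrow> chi / q) at_top)"
    and x: "0 \<le> x" and c: "c \<in> {clo..chi}"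
  show "W (x, c) = Vval M mu sig q B {clo..chi} x c"
    by (rule visc_super_limit_eq_Vval[OF assms(1,3-6), of mu W Ck]) (use H x c in auto)
qed

end
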